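(* Let $\mathcal{X}^A$ and $\mathcal{X}^B$ be irreducible, time-homogeneous, continuous-time Markov chains on the finite state spaces $\mathcal{V}^A=\{-r+3,\dots,0,1,2\}$ ($r\ge 2$) and $\mathcal{V}^B=\{1,2,\dots,s\}$ ($s\ge 2$), and let $\mathcal{X}$ be the chain glued from them at the states $1$ and $2$, with transition rate matrix $Q$. Then the stationary distribution $\pi=(\pi_{-r+3},\dots,\pi_s)\in\mathbb{R}^{r+s-2}$ of $\mathcal{X}$ is the unique solution of the following system of linear equations: \begin{align*} (\pi_{-r+3},\pi_{-r+4},\dots,\pi_0)^{\mathrm T}&=\pi_1 v+\pi_2 w,\\ (\pi_3,\pi_4,\dots,\pi_s)^{\mathrm T}&=\pi_1 x+\pi_2 y,\\ (q^A_{1A2}+q^B_{1B2})\,\pi_1&=(q^A_{2A1}+q^B_{2B1})\,\pi_2,\\ \sum_{i=-r+3}^{s}\pi_i&=1. \end{align*} Specifically, \begin{align*} \pi_1&=\frac{q^A_{2A1}+q^B_{2B1}}{(q^A_{2A1}+q^B_{2B1})\left(\sum_i v_i+\sum_j x_j +1\right)+(q^A_{1A2}+q^B_{1B2})\left(\sum_i w_i +\sum_j y_j +1\right)},\\ \pi_2&=\frac{q^A_{1A2}+q^B_{1B2}}{(q^A_{2A1}+q^B_{2B1})\left(\sum_i v_i+\sum_j x_j +1\right)+(q^A_{1A2}+q^B_{1B2})\left(\sum_i w_i +\sum_j y_j +1\right)}, \end{align*} where $i$ ranges over $\mathcal{S}^A$ and $j$ over $\mathcal{S}^B$, while $(\pi_{-r+3},\dots,\pi_0)$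 and $(\pi_3,\dots,\pi_s)$ follow from the first two equations of the system.
   Context: Setting. $Q^A$ and $Q^B$ are the transition rate matrices of $\mathcal{X}^A$ and $\mathcal{X}^B$: for $i\ne j$, $Q^\delta_{ij}\ge 0$ is the transition rate from $i$ to $j$, and $Q^\delta_{ii}=-\sum_{j\neq i}Q^\delta_{ij}$ ($\delta\in\{A,B\}$). Put $\mathcal{S}^A=\mathcal{V}^A\setminus\{1,2\}=\{-r+3,\dots,0\}$ and $\mathcal{S}^B=\mathcal{V}^B\setminus\{1,2\}=\{3,\dots,s\}$ (possibly empty). Glued chain. $\mathcal{X}$ is the continuous-time Markov chain on $\mathcal{S}^A\cup\{1,2\}\cup\mathcal{S}^B=\{-r+3,\dots,s\}$ with transition rate matrix $$Q_{ij}=Q^A_{ij}\,\mathbf 1(i,j\le 2)+Q^B_{ij}\,\mathbf 1(i,j\ge 1).$$ Its stationary distribution $\pi$ is the probability vector with $\pi^{\mathrm T}Q=0$; by irreducibility it exists uniquely and is strictly positive. Hitting times. For $\delta\in\{A,B\}$, $\varepsilon\in\{1,2\}$, $$\sigma^\delta_\varepsilon=\begin{cases}\inf\{t>0\,|\,\exists u\in(0,t):\ \mathcal{X}^\delta_u\ne\varepsilon,\ \mathcal{X}^\delta_t=\varepsilon\},&\text{if }\mathcal{X}^\delta_0=\varepsilon,\\ \inf\{t>0\,|\,\mathcal{X}^\delta_t=\varepsilon\},&\text{otherwise.}\end{cases}$$ Excursion probabilities and intensities. For $\delta\in\{A,B\}$ and $\varepsilon,\varepsilon'\in\{1,2\}$,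 $$p^\delta_{\varepsilon\delta\varepsilon'}=\mathrm P(\sigma^\delta_{\varepsilon'}<\sigma^\delta_{3-\varepsilon'}\,|\,\mathcal{X}^\delta_0=\varepsilon),\qquad q_{\varepsilon\delta}=-Q^\delta_{\varepsilon\varepsilon},\qquad q^\delta_{\varepsilon\delta\varepsilon'}=q_{\varepsilon\delta}\,p^\delta_{\varepsilon\delta\varepsilon'}.$$ (For example, $q^A_{1A2}=-Q^A_{11}\,\mathrm P(\sigma^A_2<\sigma^A_1\,|\,\mathcal{X}^A_0=1)$.) Occupation times. For $k\in\mathcal{S}^\delta$, $\chi^\delta_{\varepsilon'}(k)=\int_0^{\sigma^\delta_{\varepsilon'}}\mathbf 1(\mathcal{X}^\delta_t=k)\,\mathrm dt$, and $$\mathrm E_{\varepsilon\varepsilon'}[\chi^\delta_{\varepsilon'}(k)]=\frac{\mathrm E_\varepsilon[\chi^\delta_{\varepsilon'}(k)\mathbf 1(\sigma^\delta_{\varepsilon'}<\sigma^\delta_{3-\varepsilon'})]}{\mathrm P_\varepsilon(\sigma^\delta_{\varepsilon'}<\sigma^\delta_{3-\varepsilon'})}$$ if the denominator is nonzero, and $0$ otherwise; here $\mathrm P_\varepsilon,\mathrm E_\varepsilon$ are probability and expectation for the process started from $\varepsilon$. Vectors. $v,w\in[0,\infty)^{r-2}$ (indexed by $\mathcal{S}^A$) and $x,y\in[0,\infty)^{s-2}$ (indexed by $\mathcal{S}^B$) are \begin{align*} v_i&=q^A_{1A1}\mathrm E_{11}[\chi^A_1(i)]+q^A_{1A2}\mathrm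 E_{12}[\chi^A_2(i)],\\ w_i&=q^A_{2A2}\mathrm E_{22}[\chi^A_2(i)]+q^A_{2A1}\mathrm E_{21}[\chi^A_1(i)]\qquad(i\in\mathcal{S}^A),\\ x_j&=q^B_{1B1}\mathrm E_{11}[\chi^B_1(j)]+q^B_{1B2}\mathrm E_{12}[\chi^B_2(j)],\\ y_j&=q^B_{2B2}\mathrm E_{22}[\chi^B_2(j)]+q^B_{2B1}\mathrm E_{21}[\chi^B_1(j)]\qquad(j\in\mathcal{S}^B). \end{align*} *)

theory Defs
  imports "HOL-Probability.Probability"
begin

definition rate_matrix :: "int set \<Rightarrow> (int \<Rightarrow> int \<Rightarrow> real) \<Rightarrow> bool" where
  "rate_matrix V Q \<longleftrightarrow>
     (\<forall>i\<in>V. \<forall>j\<in>V. i \<noteq> j \<longrightarrow> 0 \<le> Q i j) \<and>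
     (\<forall>i\<in>V. Q i i = - (\<Sum>j\<in>V - {i}. Q i j))"

text \<open>
  The chain is given by the family of its laws: \<open>M i\<close> is the probability space
  on which the process \<open>X\<close> is started from \<open>i\<close>, so that probability and expectation
  under \<open>M i\<close> are those conditional on the initial state \<open>i\<close>.
  Only the times \<open>t \<ge> 0\<close> matter. Paths are right-continuous for the discrete topology.
\<close>

locale ctmc =
  fixes V :: "int set"
    and Q :: "int \<Rightarrow> int \<Rightarrow> real"
    and M :: "int \<Rightarrow> 'w measure"
    and X :: "real \<Rightarrow> 'w \<Rightarrow> int"
  assumes finite_states: "finite V"
    and rate_matrix: "rate_matrix V Q"
    and prob_space: "i \<in> V \<Longrightarrow> prob_space (M i)"
    and measurable: "i \<in> V \<Longrightarrow> 0 \<le> t \<Longrightarrow> X t \<in> measurable (M i) (count_space V)"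
    and start: "i \<in> V \<Longrightarrow> AE \<omega> in M i. X 0 \<omega> = i"
    and right_continuous:
      "i \<in> V \<Longrightarrow> \<omega> \<in> space (M i) \<Longrightarrow> 0 \<le> t \<Longrightarrow> \<forall>\<^sub>F u in at_right t. X u \<omega> = X t \<omega>"
    and markov_homogeneous:
      "i \<in> V \<Longrightarrow> 0 \<le> \<tau> 0 \<Longrightarrow> (\<And>k. k \<le> n \<Longrightarrow> \<tau> k < \<tau> (Suc k)) \<Longrightarrow>
       (\<And>k. k \<le> Suc n \<Longrightarrow> \<iota> k \<in> V) \<Longrightarrow>
       \<P>(\<omega> in M i. \<forall>k\<le>n. X (\<tau> k) \<omega> = \<iota> k) \<noteq> 0 \<Longrightarrow>
       \<P>(\<omega> in M i. X (\<tau> (Suc n)) \<omega> = \<iota> (Suc n) \<bar> \<forall>k\<le>n. X (\<tau> k) \<omega> = \<iota> k) =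
       \<P>(\<omega> in M (\<iota> n). X (\<tau> (Suc n) - \<tau> n) \<omega> = \<iota> (Suc n))"
    and transition_rate:
      "i \<in> V \<Longrightarrow> j \<in> V \<Longrightarrow> i \<noteq> j \<Longrightarrow>
       ((\<lambda>h. \<P>(\<omega> in M i. X h \<omega> = j) / h) \<longlongrightarrow> Q i j) (at_right 0)"

definition irreducible_chain ::
    "int set \<Rightarrow> (int \<Rightarrow> 'w measure) \<Rightarrow> (real \<Rightarrow> 'w \<Rightarrow> int) \<Rightarrow> bool" where
  "irreducible_chain V M X \<longleftrightarrow>
     (\<forall>i\<in>V. \<forall>j\<in>V. \<exists>t\<ge>0. 0 < \<P>(\<omega> in M i. X t \<omega> = j))"

definition glued_rates ::
    "(int \<Rightarrow> int \<Rightarrow> real) \<Rightarrow> (int \<Rightarrow> int \<Rightarrow> real) \<Rightarrow> int \<Rightarrow> int \<Rightarrow> real" where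
  "glued_rates QA QB i j =
     (if i \<le> 2 \<and> j \<le> 2 then QA i j else 0) + (if 1 \<le> i \<and> 1 \<le> j then QB i j else 0)"

definition stationary_distribution ::
    "int set \<Rightarrow> (int \<Rightarrow> int \<Rightarrow> real) \<Rightarrow> (int \<Rightarrow> real) \<Rightarrow> bool" where
  "stationary_distribution V Q \<pi> \<longleftrightarrow>
     (\<forall>i\<in>V. 0 \<le> \<pi> i) \<and> (\<Sum>i\<in>V. \<pi> i) = 1 \<and> (\<forall>j\<in>V. (\<Sum>i\<in>V. \<pi> i * Q i j) = 0)"

definition hitting_time :: "(real \<Rightarrow> 'w \<Rightarrow> int) \<Rightarrow> int \<Rightarrow> 'w \<Rightarrow> ereal" where
  "hitting_time X e \<omega> =
     (if X 0 \<omega> = e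
      then Inf {ereal t | t. 0 < t \<and> (\<exists>u\<in>{0<..<t}. X u \<omega> \<noteq> e \<and> X t \<omega> = e)}
      else Inf {ereal t | t. 0 < t \<and> X t \<omega> = e})"

text \<open>In the following, \<open>e\<close> and \<open>e'\<close> range over \<open>{1, 2}\<close>, so \<open>3 - e'\<close> is the other state.\<close>

definition excursion_prob ::
    "(int \<Rightarrow> 'w measure) \<Rightarrow> (real \<Rightarrow> 'w \<Rightarrow> int) \<Rightarrow> int \<Rightarrow> int \<Rightarrow> real" where
  "excursion_prob M X e e' =
     \<P>(\<omega> in M e. hitting_time X e' \<omega> < hitting_time X (3 - e') \<omega>)"

definition excursion_intensity ::
    "(int \<Rightarrow> int \<Rightarrow> real) \<Rightarrow> (int \<Rightarrow> 'w measure) \<Rightarrow> (real \<Rightarrow> 'w \<Rightarrow> int) \<Rightarrow> int \<Rightarrow> int \<Rightarrow> real" where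
  "excursion_intensity Q M X e e' = - Q e e * excursion_prob M X e e'"

definition occupation_time :: "(real \<Rightarrow> 'w \<Rightarrow> int) \<Rightarrow> int \<Rightarrow> int \<Rightarrow> 'w \<Rightarrow> ennreal" where
  "occupation_time X e' k \<omega> =
     (\<integral>\<^sup>+t\<in>{t. 0 \<le> t \<and> ereal t < hitting_time X e' \<omega>}. indicator {k} (X t \<omega>) \<partial>lborel)"

definition cond_occupation ::
    "(int \<Rightarrow> 'w measure) \<Rightarrow> (real \<Rightarrow> 'w \<Rightarrow> int) \<Rightarrow> int \<Rightarrow> int \<Rightarrow> int \<Rightarrow> real" where
  "cond_occupation M X e e' k =
     (if excursion_prob M X e e' \<noteq> 0
      then enn2real (\<integral>\<^sup>+\<omega>\<in>{\<omega>. hitting_time X e' \<omega> < hitting_time X (3 - e') \<omega>}.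
                       occupation_time X e' k \<omega> \<partial>M e) / excursion_prob M X e e'
      else 0)"

definition excursion_occupation ::
    "(int \<Rightarrow> int \<Rightarrow> real) \<Rightarrow> (int \<Rightarrow> 'w measure) \<Rightarrow> (real \<Rightarrow> 'w \<Rightarrow> int) \<Rightarrow> int \<Rightarrow> int \<Rightarrow> real" where
  "excursion_occupation Q M X e k =
     excursion_intensity Q M X e e * cond_occupation M X e e k +
     excursion_intensity Q M X e (3 - e) * cond_occupation M X e (3 - e) k"

end

theory Submission
  imports Defs
begin

text \<open>
  The system of equations comes from decomposing the path of a chain into excursions. An
  excursion from a gate \<open>e\<close>, one of the states \<open>1\<close> and \<open>2\<close>, consists of the stay in \<open>e\<close> and the
  time up to the return to \<open>e\<close> or the arrival at the other gate \<open>c\<close>. Give \<open>e\<close> the mass \<open>1\<close> and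
  every \<open>i\<close> outside \<open>{e, c}\<close> the expected time spent there during an excursion, multiplied by the
  exit rate \<open>- Q e e\<close>. This row vector \<open>\<mu>\<close> satisfies \<open>(\<mu> Q)\<^sub>j = 0\<close> for \<open>j\<close> outside \<open>{e, c}\<close>,
  while \<open>(\<mu> Q)\<^sub>c\<close> is the intensity of excursions that end in \<open>c\<close> (\<open>excursion_balance\<close>).

  The chain is given by its finite-dimensional distributions and its right-continuous paths, and
  the excursion equations are obtained from the values on a grid of mesh \<open>d\<close>. There the Markov
  property is a statement about finitely many times (\<open>grid_markov\<close>), and the expected numbers of
  visits within an excursion satisfy \<open>N = N P\<close> off \<open>{e, c}\<close> (\<open>grid_visits_balance\<close>). Dividing
  by \<open>d\<close> turns \<open>P - I\<close> into \<open>Q\<close> as \<open>d\<close> tends to \<open>0\<close>. That \<open>N\<close> itself converges is a matter of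
  paths: sampled at grid points to the right, occupation times and the order of the hitting
  times of a right-continuous path are recovered in the limit (\<open>eventually_unfinished_iff\<close>,
  \<open>eventually_hit_target_iff\<close>). Expectations follow by dominated convergence along dyadic grids:
  on a finer grid an excursion can only be seen to end earlier, and on one fixed fine grid its
  mean duration is finite (\<open>summable_grid_visit\<close>). The latter rests on a Lyapunov function that
  irreducibility provides (\<open>lyapunov_function\<close>).

  What remains is linear algebra. The same Lyapunov function shows that the rates restricted
  to the states other than \<open>1\<close> and \<open>2\<close> have no nonzero left null vector (\<open>left_null_vector_zero\<close>). Hence
  the balance equations at these states determine a vector by its values at \<open>1\<close> and \<open>2\<close>, as the
  combination of the two excursion measures. They split into one system for each of the glued
  chains. The balance equations at \<open>1\<close> and \<open>2\<close> are then equivalent to each other and say that the net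
  flow from \<open>1\<close> to \<open>2\<close> vanishes, which is the third equation. Its coefficients are positive, so
  that normalisation gives the solution in closed form and makes it nonnegative.
\<close>

section \<open>Transition probabilities and the chain on a time grid\<close>

context ctmc
begin

definition trans_prob :: "real \<Rightarrow> int \<Rightarrow> int \<Rightarrow> real" where
  "trans_prob t i j = \<P>(\<omega> in M i. X t \<omega> = j)"

definition grid :: "real \<Rightarrow> 'w \<Rightarrow> nat \<Rightarrow> int" where
  "grid d \<omega> m = X (real m * d) \<omega>"

lemma path_in_states: "i \<in> V \<Longrightarrow> \<omega> \<in> space (M i) \<Longrightarrow> 0 \<le> t \<Longrightarrow> X t \<omega> \<in> V"
  using measurable_space[OF measurable] by auto

lemma state_event: "i \<in> V \<Longrightarrow> 0 \<le> t \<Longrightarrow> {\<omega> \<in> space (M i). X t \<omega> \<in> B} \<in> sets (M i)"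
proof -
  assume i: "i \<in> V" "0 \<le> t"
  have "X t -` (B \<inter> V) \<inter> space (M i) \<in> sets (M i)"
    by (rule measurable_sets[OF measurable[OF i]]) auto
  moreover have "X t -` (B \<inter> V) \<inter> space (M i) = {\<omega> \<in> space (M i). X t \<omega> \<in> B}"
    using path_in_states i by auto
  ultimately show ?thesis by simp
qed

lemma trans_prob_nonneg: "0 \<le> trans_prob t i j"
  by (simp add: trans_prob_def)

lemma sum_trans_prob:
  assumes "i \<in> V" "0 \<le> t"
  shows "(\<Sum>j\<in>V. trans_prob t i j) = 1"
proof -
  interpret prob_space "M i" by (rule prob_space) fact
  have "prob {\<omega> \<in> space (M i). True} = (\<Sum>j\<in>V. prob {\<omega> \<in> space (M i). X t \<omega> = j})"
    using state_event[OF assms, of "{_}"] path_in_states[OF assms(1) _ assms(2)]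
    by (intro prob_sum finite_states) auto
  then show ?thesis by (simp add: trans_prob_def prob_space)
qed

lemma rate_nonneg: "i \<in> V \<Longrightarrow> j \<in> V \<Longrightarrow> i \<noteq> j \<Longrightarrow> 0 \<le> Q i j"
  using rate_matrix by (auto simp: rate_matrix_def)

lemma row_sum_rates: "i \<in> V \<Longrightarrow> (\<Sum>j\<in>V. Q i j) = 0"
  using rate_matrix finite_states by (simp add: rate_matrix_def sum.remove)

lemma trans_prob_derivative:
  assumes "i \<in> V" "j \<in> V"
  shows "((\<lambda>h. (trans_prob h i j - of_bool (i = j)) / h) \<longlongrightarrow> Q i j) (at_right 0)"
proof (cases "i = j")
  case False
  then show ?thesis using transition_rate[OF assms False] by (simp add: trans_prob_def)
next
  case True
  have "((\<lambda>h. - (\<Sum>k\<in>V - {i}. trans_prob h i k / h)) \<longlongrightarrow> - (\<Sum>k\<in>V - {i}. Q i k)) (at_right 0)"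
    using transition_rate[OF assms(1)] by (auto intro!: tendsto_intros simp: trans_prob_def)
  also have "- (\<Sum>k\<in>V - {i}. Q i k) = Q i j"
    using rate_matrix assms True by (simp add: rate_matrix_def)
  finally show ?thesis
  proof (rule Lim_transform_eventually)
    have "- (\<Sum>k\<in>V - {i}. trans_prob h i k / h) = (trans_prob h i j - of_bool (i = j)) / h" if "0 < h" for h
      using sum_trans_prob[OF assms(1), of h] that True assms finite_states
      by (simp add: sum.remove[OF finite_states assms(1)] sum_divide_distrib[symmetric] field_simps)
    then show "\<forall>\<^sub>F h in at_right 0.
        - (\<Sum>k\<in>V - {i}. trans_prob h i k / h) = (trans_prob h i j - of_bool (i = j)) / h"
      by (auto simp: eventually_at_right_field intro!: exI[of _ 1])
  qed
qed

lemma grid_in_states: "i \<in> V \<Longrightarrow> \<omega> \<in> space (M i) \<Longrightarrow> 0 \<le> d \<Longrightarrow> grid d \<omega> m \<in> V"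
  by (simp add: grid_def path_in_states)

lemma cylinder_event:
  assumes "i \<in> V" "0 \<le> d"
  shows "{\<omega> \<in> space (M i). \<forall>k\<le>m. grid d \<omega> k = \<iota> k} \<in> sets (M i)"
proof -
  have "{\<omega> \<in> space (M i). \<forall>k\<le>m. grid d \<omega> k = \<iota> k}
      = (\<Inter>k\<le>m. {\<omega> \<in> space (M i). X (real k * d) \<omega> \<in> {\<iota> k}})"
    by (auto simp: grid_def)
  also have "\<dots> \<in> sets (M i)"
    by (intro sets.finite_INT state_event) (use assms in auto)
  finally show ?thesis .
qed

lemma prefix_decomposition:
  assumes "i \<in> V" "0 \<le> d" and prefix: "\<And>f g. (\<And>k. k \<le> m \<Longrightarrow> f k = g k) \<Longrightarrow> A f = A g"
  shows "{\<omega> \<in> space (M i). A (grid d \<omega>)}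
       = (\<Union>\<iota>\<in>{\<iota> \<in> {..m} \<rightarrow>\<^sub>E V. A \<iota>}. {\<omega> \<in> space (M i). \<forall>k\<le>m. grid d \<omega> k = \<iota> k})"
proof (intro equalityI subsetI)
  fix \<omega> assume w: "\<omega> \<in> {\<omega> \<in> space (M i). A (grid d \<omega>)}"
  have "A (restrict (grid d \<omega>) {..m})" using w prefix[of "restrict (grid d \<omega>) {..m}" "grid d \<omega>"] by simp
  then show "\<omega> \<in> (\<Union>\<iota>\<in>{\<iota> \<in> {..m} \<rightarrow>\<^sub>E V. A \<iota>}. {\<omega> \<in> space (M i). \<forall>k\<le>m. grid d \<omega> k = \<iota> k})"
    using w grid_in_states[OF assms(1) _ assms(2)]
    by (intro UN_I[of "restrict (grid d \<omega>) {..m}"]) auto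
next
  fix \<omega> assume "\<omega> \<in> (\<Union>\<iota>\<in>{\<iota> \<in> {..m} \<rightarrow>\<^sub>E V. A \<iota>}. {\<omega> \<in> space (M i). \<forall>k\<le>m. grid d \<omega> k = \<iota> k})"
  then show "\<omega> \<in> {\<omega> \<in> space (M i). A (grid d \<omega>)}" using prefix by blast
qed

lemma prefix_event:
  assumes "i \<in> V" "0 \<le> d" "\<And>f g. (\<And>k. k \<le> m \<Longrightarrow> f k = g k) \<Longrightarrow> A f = A g"
  shows "{\<omega> \<in> space (M i). A (grid d \<omega>)} \<in> sets (M i)"
proof -
  have "finite {\<iota> \<in> {..m} \<rightarrow>\<^sub>E V. A \<iota>}"
    by (rule finite_subset[OF _ finite_PiE[of "{..m}" "\<lambda>_. V"]]) (auto simp: finite_states)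
  then have "(\<Union>\<iota>\<in>{\<iota> \<in> {..m} \<rightarrow>\<^sub>E V. A \<iota>}. {\<omega> \<in> space (M i). \<forall>k\<le>m. grid d \<omega> k = \<iota> k}) \<in> sets (M i)"
    by (intro sets.finite_UN cylinder_event assms)
  moreover have "{\<omega> \<in> space (M i). A (grid d \<omega>)}
       = (\<Union>\<iota>\<in>{\<iota> \<in> {..m} \<rightarrow>\<^sub>E V. A \<iota>}. {\<omega> \<in> space (M i). \<forall>k\<le>m. grid d \<omega> k = \<iota> k})"
    by (rule prefix_decomposition[OF assms(1,2)]) (rule assms(3))
  ultimately show ?thesis by simp
qed

lemma cylinder_step:
  assumes i: "i \<in> V" and d: "0 < d" and \<iota>: "\<And>k. k \<le> m \<Longrightarrow> \<iota> k \<in> V" and j: "j \<in> V"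
  shows "\<P>(\<omega> in M i. (\<forall>k\<le>m. grid d \<omega> k = \<iota> k) \<and> grid d \<omega> (Suc m) = j)
       = \<P>(\<omega> in M i. \<forall>k\<le>m. grid d \<omega> k = \<iota> k) * trans_prob d (\<iota> m) j"
proof -
  interpret prob_space "M i" by (rule prob_space) fact
  define \<kappa> where "\<kappa> = \<iota>(Suc m := j)"
  define \<tau> where "\<tau> = (\<lambda>k. real k * d)"
  have step: "\<tau> (Suc m) - \<tau> m = d" by (simp add: \<tau>_def algebra_simps)
  have past: "(\<forall>k\<le>m. X (\<tau> k) \<omega> = \<kappa> k) \<longleftrightarrow> (\<forall>k\<le>m. grid d \<omega> k = \<iota> k)" for \<omega>
    by (auto simp: \<kappa>_def \<tau>_def grid_def)
  have last: "X (\<tau> (Suc m)) \<omega> = \<kappa> (Suc m) \<longleftrightarrow> grid d \<omega> (Suc m) = j" for \<omega>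
    by (auto simp: \<kappa>_def \<tau>_def grid_def)
  show ?thesis
  proof (cases "\<P>(\<omega> in M i. \<forall>k\<le>m. grid d \<omega> k = \<iota> k) = 0")
    case True
    have "\<P>(\<omega> in M i. (\<forall>k\<le>m. grid d \<omega> k = \<iota> k) \<and> grid d \<omega> (Suc m) = j)
        \<le> \<P>(\<omega> in M i. \<forall>k\<le>m. grid d \<omega> k = \<iota> k)"
      using d by (intro finite_measure_mono cylinder_event i) (blast, simp)
    with True show ?thesis by (simp add: measure_le_0_iff)
  next
    case False
    have "\<P>(\<omega> in M i. X (\<tau> (Suc m)) \<omega> = \<kappa> (Suc m) \<bar> \<forall>k\<le>m. X (\<tau> k) \<omega> = \<kappa> k)
        = \<P>(\<omega> in M (\<kappa> m). X (\<tau> (Suc m) - \<tau> m) \<omega> = \<kappa> (Suc m))"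
    proof (rule markov_homogeneous[OF i])
      show "0 \<le> \<tau> 0" by (simp add: \<tau>_def)
      show "\<tau> k < \<tau> (Suc k)" for k using d by (simp add: \<tau>_def)
      show "\<kappa> k \<in> V" if "k \<le> Suc m" for k using that \<iota> j by (auto simp: \<kappa>_def le_Suc_eq)
      show "\<P>(\<omega> in M i. \<forall>k\<le>m. X (\<tau> k) \<omega> = \<kappa> k) \<noteq> 0" using False by (simp only: past) simp
    qed
    also have "\<dots> = trans_prob d (\<iota> m) j" by (simp add: step trans_prob_def \<kappa>_def)
    finally show ?thesis
      using False unfolding cond_prob_def past last by (simp add: field_simps conj_commute)
  qed
qed

text \<open>The Markov property in the form used below: the past enters only through an event
  determined by finitely many grid values, and such an event is a finite disjoint union of
  cylinders.\<close>

lemma grid_markov: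
  assumes i: "i \<in> V" and d: "0 < d" and kj: "k \<in> V" "j \<in> V"
    and prefix: "\<And>f g. (\<And>l. l \<le> m \<Longrightarrow> f l = g l) \<Longrightarrow> A f = A g"
  shows "\<P>(\<omega> in M i. A (grid d \<omega>) \<and> grid d \<omega> m = k \<and> grid d \<omega> (Suc m) = j)
       = \<P>(\<omega> in M i. A (grid d \<omega>) \<and> grid d \<omega> m = k) * trans_prob d k j"
proof -
  interpret prob_space "M i" by (rule prob_space) fact
  define I where "I = {\<iota> \<in> {..m} \<rightarrow>\<^sub>E V. A \<iota> \<and> \<iota> m = k}"
  have fin: "finite I"
    unfolding I_def by (rule finite_subset[OF _ finite_PiE[of "{..m}" "\<lambda>_. V"]]) (auto simp: finite_states)
  have ex1: "\<exists>!\<iota>. \<iota> \<in> I \<and> (\<forall>l\<le>m. grid d \<omega> l = \<iota> l)"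
    if "A (grid d \<omega>)" "grid d \<omega> m = k" "\<omega> \<in> space (M i)" for \<omega>
  proof (rule ex1I[of _ "restrict (grid d \<omega>) {..m}"])
    have "A (restrict (grid d \<omega>) {..m})"
      using that prefix[of "restrict (grid d \<omega>) {..m}" "grid d \<omega>"] by simp
    then show "restrict (grid d \<omega>) {..m} \<in> I \<and> (\<forall>l\<le>m. grid d \<omega> l = restrict (grid d \<omega>) {..m} l)"
      using grid_in_states[OF i that(3)] d that by (auto simp: I_def)
    show "\<iota> = restrict (grid d \<omega>) {..m}" if "\<iota> \<in> I \<and> (\<forall>l\<le>m. grid d \<omega> l = \<iota> l)" for \<iota>
      using that by (auto simp: I_def fun_eq_iff PiE_iff extensional_def)
  qed
  have prefix_if: "A (grid d \<omega>) \<and> grid d \<omega> m = k" if "\<iota> \<in> I" "\<forall>l\<le>m. grid d \<omega> l = \<iota> l" for \<omega> \<iota>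
    using that prefix[of "grid d \<omega>" \<iota>] by (auto simp: I_def)
  have ev: "{\<omega> \<in> space (M i). A (grid d \<omega>) \<and> grid d \<omega> m = k} \<in> sets (M i)"
  proof (rule prefix_event[where m = "m" and A = "\<lambda>f. A f \<and> f m = k", OF i])
    show "0 \<le> d" using d by simp
    fix f g :: "nat \<Rightarrow> int" assume h: "\<And>l. l \<le> m \<Longrightarrow> f l = g l"
    have "A f = A g" by (rule prefix) (simp add: h)
    then show "(A f \<and> f m = k) = (A g \<and> g m = k)" by (simp add: h)
  qed
  have ev1: "{\<omega> \<in> space (M i). A (grid d \<omega>) \<and> grid d \<omega> m = k \<and> grid d \<omega> (Suc m) = j} \<in> sets (M i)"
  proof (rule prefix_event[where m = "Suc m" and A = "\<lambda>f. A f \<and> f m = k \<and> f (Suc m) = j", OF i])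
    show "0 \<le> d" using d by simp
    fix f g :: "nat \<Rightarrow> int" assume h: "\<And>l. l \<le> Suc m \<Longrightarrow> f l = g l"
    have "A f = A g" by (rule prefix) (simp add: h)
    then show "(A f \<and> f m = k \<and> f (Suc m) = j) = (A g \<and> g m = k \<and> g (Suc m) = j)" by (simp add: h)
  qed
  have ev2: "{\<omega> \<in> space (M i). (\<forall>l\<le>m. grid d \<omega> l = \<iota> l) \<and> grid d \<omega> (Suc m) = j} \<in> sets (M i)" for \<iota>
    using d by (intro prefix_event[where m = "Suc m" and A = "\<lambda>f. (\<forall>l\<le>m. f l = \<iota> l) \<and> f (Suc m) = j", OF i])
      (simp, metis le_SucI order_refl)
  have ev3: "{\<omega> \<in> space (M i). \<forall>l\<le>m. grid d \<omega> l = \<iota> l} \<in> sets (M i)" for \<iota>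
    using d by (intro cylinder_event i) simp
  have "\<P>(\<omega> in M i. A (grid d \<omega>) \<and> grid d \<omega> m = k \<and> grid d \<omega> (Suc m) = j)
      = (\<Sum>\<iota>\<in>I. \<P>(\<omega> in M i. (\<forall>l\<le>m. grid d \<omega> l = \<iota> l) \<and> grid d \<omega> (Suc m) = j))"
  proof (rule prob_sum[OF fin ev2 ev1], rule AE_I2, intro conjI ballI impI)
    fix \<omega> \<iota> assume "\<iota> \<in> I" "(\<forall>l\<le>m. grid d \<omega> l = \<iota> l) \<and> grid d \<omega> (Suc m) = j"
    then show "A (grid d \<omega>)" and "grid d \<omega> m = k" and "grid d \<omega> (Suc m) = j" using prefix_if by blast+
  next
    fix \<omega> assume "\<omega> \<in> space (M i)" "A (grid d \<omega>) \<and> grid d \<omega> m = k \<and> grid d \<omega> (Suc m) = j"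
    then show "\<exists>!\<iota>. \<iota> \<in> I \<and> (\<forall>l\<le>m. grid d \<omega> l = \<iota> l) \<and> grid d \<omega> (Suc m) = j"
      using ex1 by metis
  qed
  also have "\<dots> = (\<Sum>\<iota>\<in>I. \<P>(\<omega> in M i. \<forall>l\<le>m. grid d \<omega> l = \<iota> l) * trans_prob d k j)"
  proof (rule sum.cong[OF refl])
    fix \<iota> assume "\<iota> \<in> I"
    then have "\<iota> l \<in> V" if "l \<le> m" for l using that by (auto simp: I_def)
    moreover have "\<iota> m = k" using \<open>\<iota> \<in> I\<close> by (simp add: I_def)
    ultimately show "\<P>(\<omega> in M i. (\<forall>l\<le>m. grid d \<omega> l = \<iota> l) \<and> grid d \<omega> (Suc m) = j)
        = \<P>(\<omega> in M i. \<forall>l\<le>m. grid d \<omega> l = \<iota> l) * trans_prob d k j"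
      using cylinder_step[OF i d, of m \<iota> j] kj by simp
  qed
  also have "\<dots> = (\<Sum>\<iota>\<in>I. \<P>(\<omega> in M i. \<forall>l\<le>m. grid d \<omega> l = \<iota> l)) * trans_prob d k j"
    by (simp add: sum_distrib_right)
  also have "(\<Sum>\<iota>\<in>I. \<P>(\<omega> in M i. \<forall>l\<le>m. grid d \<omega> l = \<iota> l))
      = \<P>(\<omega> in M i. A (grid d \<omega>) \<and> grid d \<omega> m = k)"
  proof (rule prob_sum[OF fin ev3 ev, symmetric], rule AE_I2, intro conjI ballI impI)
    fix \<omega> \<iota> assume "\<iota> \<in> I" "\<forall>l\<le>m. grid d \<omega> l = \<iota> l"
    then show "A (grid d \<omega>)" and "grid d \<omega> m = k" using prefix_if by blast+
  next
    fix \<omega> assume "\<omega> \<in> space (M i)" "A (grid d \<omega>) \<and> grid d \<omega> m = k"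
    then show "\<exists>!\<iota>. \<iota> \<in> I \<and> (\<forall>l\<le>m. grid d \<omega> l = \<iota> l)" using ex1 by simp
  qed
  finally show ?thesis .
qed

end

section \<open>Irreducibility\<close>

locale irreducible_ctmc = ctmc +
  assumes irreducible: "irreducible_chain V M X"
begin

lemma (in ctmc) trans_prob_0:
  assumes "i \<in> V" "i \<noteq> j"
  shows "trans_prob 0 i j = 0"
proof -
  interpret prob_space "M i" by (rule prob_space) fact
  show ?thesis
    unfolding trans_prob_def
    using state_event[OF assms(1), of 0 "{j}"] start[OF assms(1)] assms(2)
    by (subst prob_Collect_eq_0) (auto elim: eventually_mono)
qed

text \<open>To be outside \<open>C\<close> at time \<open>m * d\<close> the chain has to leave \<open>C\<close> in one of
  the \<open>m\<close> grid steps.\<close>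

lemma (in ctmc) escape_bound:
  assumes i: "i \<in> C" and C: "C \<subseteq> V" and d: "0 < d"
  shows "\<P>(\<omega> in M i. grid d \<omega> m \<notin> C) \<le> real m * (\<Sum>k\<in>C. \<Sum>j\<in>V - C. trans_prob d k j)"
proof (induction m)
  case 0
  have iV: "i \<in> V" using i C by auto
  interpret prob_space "M i" by (rule prob_space) fact
  have "AE \<omega> in M i. \<not> (grid d \<omega> 0 \<notin> C)"
    using start[OF iV] i by (auto simp: grid_def elim: eventually_mono)
  then have "\<P>(\<omega> in M i. grid d \<omega> 0 \<notin> C) = 0"
    using state_event[OF iV, of 0 "- C"] by (subst prob_Collect_eq_0) (auto simp: grid_def)
  then show ?case by simp
next
  case (Suc m)
  have iV: "i \<in> V" using i C by auto
  interpret prob_space "M i" by (rule prob_space) fact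
  let ?E = "\<lambda>m. {\<omega> \<in> space (M i). grid d \<omega> m \<notin> C}"
  let ?F = "\<lambda>k j. {\<omega> \<in> space (M i). True \<and> grid d \<omega> m = k \<and> grid d \<omega> (Suc m) = j}"
  have fin: "finite C" "finite (V - C)" using finite_states C by (auto intro: finite_subset)
  have E: "?E n \<in> events" for n
    using state_event[OF iV, of "real n * d" "- C"] d by (simp add: grid_def)
  have F: "?F k j \<in> events" for k j
  proof -
    have eq: "?F k j = {\<omega> \<in> space (M i). X (real m * d) \<omega> \<in> {k}} \<inter> {\<omega> \<in> space (M i). X (real (Suc m) * d) \<omega> \<in> {j}}"
      by (auto simp: grid_def)
    show ?thesis
      unfolding eq by (intro sets.Int state_event iV) (use d in simp_all)
  qed
  have sub: "?E (Suc m) \<subseteq> ?E m \<union> (\<Union>k\<in>C. \<Union>j\<in>V - C. ?F k j)"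
    using grid_in_states[OF iV] d by auto
  have "prob (?E (Suc m)) \<le> prob (?E m \<union> (\<Union>k\<in>C. \<Union>j\<in>V - C. ?F k j))"
    by (rule finite_measure_mono[OF sub]) (intro sets.Un E F sets.finite_UN fin)
  also have "\<dots> \<le> prob (?E m) + prob (\<Union>k\<in>C. \<Union>j\<in>V - C. ?F k j)"
    by (intro measure_Un_le E F sets.finite_UN fin)
  also have "prob (\<Union>k\<in>C. \<Union>j\<in>V - C. ?F k j) \<le> (\<Sum>k\<in>C. prob (\<Union>j\<in>V - C. ?F k j))"
    by (intro finite_measure_subadditive_finite fin image_subsetI sets.finite_UN F)
  also have "\<dots> \<le> (\<Sum>k\<in>C. \<Sum>j\<in>V - C. prob (?F k j))"
    by (intro sum_mono finite_measure_subadditive_finite fin image_subsetI F)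
  also have "\<dots> \<le> (\<Sum>k\<in>C. \<Sum>j\<in>V - C. trans_prob d k j)"
  proof (intro sum_mono)
    fix k j assume "k \<in> C" "j \<in> V - C"
    then have kj: "k \<in> V" "j \<in> V" using C by auto
    have "prob (?F k j) = \<P>(\<omega> in M i. True \<and> grid d \<omega> m = k) * trans_prob d k j"
      by (rule grid_markov[OF iV d kj, of m "\<lambda>_. True"]) simp
    also have "\<dots> \<le> 1 * trans_prob d k j" by (intro mult_right_mono trans_prob_nonneg prob_le_1)
    finally show "prob (?F k j) \<le> trans_prob d k j" by simp
  qed
  finally show ?case using Suc by (simp add: algebra_simps)
qed

text \<open>If all rates out of \<open>C\<close> vanish, then leaving \<open>C\<close> within a step of length \<open>t / n\<close> has
  probability \<open>o(1 / n)\<close>, so the chain does not leave \<open>C\<close> in \<open>n\<close> steps either, as \<open>n\<close> grows.\<close>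

lemma no_closed_proper_subset:
  assumes C: "C \<subseteq> V" and i: "i \<in> C" and c: "c \<in> V - C"
  shows "\<exists>k\<in>C. \<exists>j\<in>V - C. 0 < Q k j"
proof (rule ccontr)
  assume "\<not> ?thesis"
  then have zero: "Q k j = 0" if "k \<in> C" "j \<in> V - C" for k j
    using rate_nonneg[of k j] that C by (metis DiffD1 DiffD2 less_eq_real_def subsetD)
  have iV: "i \<in> V" using i C by auto
  interpret prob_space "M i" by (rule prob_space) fact
  obtain t where t: "0 \<le> t" "0 < trans_prob t i c"
    using irreducible iV c by (auto simp: irreducible_chain_def trans_prob_def)
  have "t \<noteq> 0" using trans_prob_0[OF iV, of c] t i c by (intro notI) auto
  with t have tp: "0 < t" by simp
  define S where "S d = (\<Sum>k\<in>C. \<Sum>j\<in>V - C. trans_prob d k j)" for d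
  have "((\<lambda>d. \<Sum>k\<in>C. \<Sum>j\<in>V - C. trans_prob d k j / d) \<longlongrightarrow> (\<Sum>k\<in>C. \<Sum>j\<in>V - C. Q k j)) (at_right 0)"
  proof (intro tendsto_sum)
    fix k j assume "k \<in> C" "j \<in> V - C"
    then show "((\<lambda>d. trans_prob d k j / d) \<longlongrightarrow> Q k j) (at_right 0)"
      using transition_rate[of k j] C by (auto simp: trans_prob_def)
  qed
  then have lim: "((\<lambda>d. t * (S d / d)) \<longlongrightarrow> t * 0) (at_right 0)"
    using zero by (intro tendsto_mult_left) (simp add: S_def sum_divide_distrib)
  have step: "filterlim (\<lambda>n. t / real (Suc n)) (at_right 0) sequentially"
    using tp LIMSEQ_Suc[OF lim_const_over_n[of t]]
    by (auto simp: filterlim_at intro!: always_eventually)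
  have "trans_prob t i c \<le> t * (S (t / real (Suc n)) / (t / real (Suc n)))" for n
  proof -
    let ?d = "t / real (Suc n)"
    have "trans_prob t i c \<le> \<P>(\<omega> in M i. grid ?d \<omega> (Suc n) \<notin> C)"
      unfolding trans_prob_def
      using c state_event[OF iV, of t "- C"] tp by (intro finite_measure_mono) (auto simp: grid_def)
    also have "\<dots> \<le> real (Suc n) * S ?d"
      unfolding S_def by (rule escape_bound[OF i C]) (use tp in simp)
    also have "\<dots> = t * (S ?d / ?d)" using tp by (simp add: field_simps)
    finally show ?thesis .
  qed
  then have "trans_prob t i c \<le> t * 0"
    by (intro LIMSEQ_le_const[OF filterlim_compose[OF lim step]]) auto
  with t show False by simp
qed

lemma exit_rate_pos:
  assumes "i \<in> V" "c \<in> V" "i \<noteq> c"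
  shows "Q i i < 0"
proof -
  obtain j where j: "j \<in> V - {i}" "0 < Q i j"
    using no_closed_proper_subset[of "{i}" i c] assms by auto
  have "0 < (\<Sum>k\<in>V - {i}. Q i k)"
    using j rate_nonneg[OF assms(1)] finite_states by (intro sum_pos2[of _ j]) auto
  then show ?thesis using rate_matrix assms by (simp add: rate_matrix_def)
qed

text \<open>A Lyapunov function certifies that the target \<open>c\<close> is reached in finite mean time.
  It is built by adding states one at a time to the set \<open>B\<close> on which the drift is already
  negative: some state outside \<open>B\<close> has a transition into \<open>B\<close>, where \<open>u\<close> is smaller, and a
  slight increase of \<open>u\<close> on the remaining states preserves the strict inequalities.\<close>

lemma lyapunov_function:
  assumes c: "c \<in> V"
  shows "\<exists>u. (\<forall>i\<in>V. 0 \<le> u i) \<and> (\<forall>i\<in>V - {c}. (\<Sum>j\<in>V. Q i j * u j) < 0)"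
proof -
  have "\<exists>u. (\<forall>i\<in>V. 0 \<le> u i) \<and> (\<forall>i\<in>V - {c}. (\<Sum>j\<in>V. Q i j * u j) < 0)"
    if "card (V - B) = n" "B \<subseteq> V" "c \<in> B" "\<forall>i\<in>V. 0 \<le> u i" "\<forall>i\<in>B. u i < b" "\<forall>i\<in>V - B. u i = b"
      "\<forall>i\<in>B - {c}. (\<Sum>j\<in>V. Q i j * u j) < 0" for n B and u :: "int \<Rightarrow> real" and b :: real
    using that
  proof (induction n arbitrary: B u b)
    case 0
    then have "B = V" using finite_states by auto
    then show ?case using 0 by blast
  next
    case (Suc n)
    have "V - B \<noteq> {}" using Suc.prems(1) by (metis card.empty nat.distinct(1))
    then obtain i j where i: "i \<in> V - B" and j: "j \<in> V - (V - B)" "0 < Q i j"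
      using no_closed_proper_subset[of "V - B" _ c] Suc.prems(3) c by blast
    then have j': "j \<in> B" by auto
    have "(\<Sum>k\<in>V. Q i k * u k) = (\<Sum>k\<in>V. Q i k * (u k - b))"
      using row_sum_rates[of i] i
      by (simp add: right_diff_distrib sum_subtractf sum_distrib_right[symmetric])
    also have "\<dots> < (\<Sum>k\<in>V. 0)"
    proof (rule sum_strict_mono_ex1[OF finite_states])
      show "\<forall>k\<in>V. Q i k * (u k - b) \<le> 0"
      proof
        fix k assume k: "k \<in> V"
        have "u k \<le> b" using Suc.prems(5,6) k by (cases "k \<in> B") auto
        then show "Q i k * (u k - b) \<le> 0"
          using rate_nonneg[of i k] i k Suc.prems(6)
          by (cases "k = i") (auto intro: mult_nonneg_nonpos)
      qed
      show "\<exists>k\<in>V. Q i k * (u k - b) < 0"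
        using j j' Suc.prems(5) by (intro bexI[of _ j]) (auto intro: mult_pos_neg)
    qed
    finally have drift_i: "(\<Sum>k\<in>V. Q i k * u k) < 0" by simp
    define B' where "B' = insert i B"
    define R where "R k = (\<Sum>j\<in>V - B'. Q k j)" for k
    have "\<forall>\<^sub>F e in at_right 0. \<forall>k\<in>B' - {c}. (\<Sum>j\<in>V. Q k j * u j) + e * R k < 0"
    proof (rule eventually_ball_finite)
      show "finite (B' - {c})"
        using Suc.prems(2) i by (intro finite_subset[OF _ finite_states]) (auto simp: B'_def)
      show "\<forall>k\<in>B' - {c}. \<forall>\<^sub>F e in at_right 0. (\<Sum>j\<in>V. Q k j * u j) + e * R k < 0"
      proof
        fix k assume "k \<in> B' - {c}"
        then have "(\<Sum>j\<in>V. Q k j * u j) < 0" using drift_i Suc.prems(7) by (auto simp: B'_def)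
        moreover have "((\<lambda>e. (\<Sum>j\<in>V. Q k j * u j) + e * R k) \<longlongrightarrow> (\<Sum>j\<in>V. Q k j * u j) + 0 * R k) (at_right 0)"
          by (intro tendsto_intros)
        ultimately show "\<forall>\<^sub>F e in at_right 0. (\<Sum>j\<in>V. Q k j * u j) + e * R k < 0"
          by (intro order_tendstoD(2)) auto
      qed
    qed
    then have "\<forall>\<^sub>F e::real in at_right 0. 0 < e \<and> (\<forall>k\<in>B' - {c}. (\<Sum>j\<in>V. Q k j * u j) + e * R k < 0)"
      using eventually_at_right_less[of "0::real"] by eventually_elim auto
    then obtain e where e: "0 < e" "\<And>k. k \<in> B' - {c} \<Longrightarrow> (\<Sum>j\<in>V. Q k j * u j) + e * R k < 0"
      using eventually_happens'[OF trivial_limit_at_right_real] by blast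
    define u' where "u' k = u k + (if k \<in> V - B' then e else 0)" for k
    show ?case
    proof (rule Suc.IH[of B' u' "b + e"])
      have "Suc (card (V - B')) = card (insert i (V - B'))"
        by (rule card_insert_disjoint[symmetric]) (auto simp: B'_def finite_states)
      also have "insert i (V - B') = V - B" using i by (auto simp: B'_def)
      also have "card (V - B) = Suc n" by (rule Suc.prems(1))
      finally show "card (V - B') = n" by simp
      show "B' \<subseteq> V" "c \<in> B'" using Suc.prems i by (auto simp: B'_def)
      show "\<forall>i\<in>V. 0 \<le> u' i" using Suc.prems(4) e by (auto simp: u'_def)
      show "\<forall>k\<in>B'. u' k < b + e"
      proof
        fix k assume "k \<in> B'"
        then have "u k \<le> b" using Suc.prems(5,6) i by (auto simp: B'_def intro: less_imp_le)
        then show "u' k < b + e" using \<open>k \<in> B'\<close> e by (simp add: u'_def)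
      qed
      show "\<forall>k\<in>V - B'. u' k = b + e" using Suc.prems(6) by (auto simp: u'_def B'_def)
      show "\<forall>k\<in>B' - {c}. (\<Sum>j\<in>V. Q k j * u' j) < 0"
      proof
        fix k assume k: "k \<in> B' - {c}"
        have "(\<Sum>j\<in>V. Q k j * (if j \<in> V - B' then e else 0)) = (\<Sum>j\<in>V - B'. Q k j * e)"
          by (rule sum.mono_neutral_cong_right) (use finite_states in auto)
        then have "(\<Sum>j\<in>V. Q k j * u' j) = (\<Sum>j\<in>V. Q k j * u j) + e * R k"
          by (simp add: u'_def R_def distrib_left sum.distrib sum_distrib_left mult.commute)
        then show "(\<Sum>j\<in>V. Q k j * u' j) < 0" using e(2)[OF k] by simp
      qed
    qed
  qed
  from this[OF refl, of "{c}" "\<lambda>i. if i = c then 0 else 1" 1] c show ?thesis by auto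
qed

text \<open>The absolute values of a left null vector of the rates restricted to \<open>S\<close> have
  nonnegative net inflow at every state of \<open>S\<close>; pairing them with the Lyapunov function, whose
  drift is strictly negative on \<open>S\<close>, leaves room only for the zero vector.\<close>

lemma left_null_vector_zero:
  assumes c: "c \<in> V" and S: "S \<subseteq> V - {c}"
    and null: "\<And>j. j \<in> S \<Longrightarrow> (\<Sum>i\<in>S. z i * Q i j) = 0"
    and i: "i \<in> S"
  shows "z i = 0"
proof -
  obtain u where u: "\<And>i. i \<in> V \<Longrightarrow> 0 \<le> u i" "\<And>i. i \<in> V - {c} \<Longrightarrow> (\<Sum>j\<in>V. Q i j * u j) < 0"
    using lyapunov_function[OF c] by blast
  have fin: "finite S" using S finite_states by (metis finite_Diff finite_subset)
  have inflow: "0 \<le> (\<Sum>i\<in>S. \<bar>z i\<bar> * Q i j)" if j: "j \<in> S" for j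
  proof -
    have jV: "j \<in> V" using j S by auto
    have Qjj: "Q j j \<le> 0"
      using rate_matrix jV rate_nonneg[OF jV] by (auto simp: rate_matrix_def intro!: sum_nonneg)
    have eq: "z j * Q j j = - (\<Sum>i\<in>S - {j}. z i * Q i j)"
      using null[OF j] fin j by (simp add: sum.remove)
    have "- (\<bar>z j\<bar> * Q j j) = \<bar>z j * Q j j\<bar>"
      using Qjj by (simp add: abs_mult)
    also have "\<dots> \<le> (\<Sum>i\<in>S - {j}. \<bar>z i * Q i j\<bar>)"
      unfolding eq abs_minus_cancel by (rule sum_abs)
    also have "\<dots> = (\<Sum>i\<in>S - {j}. \<bar>z i\<bar> * Q i j)"
      using rate_nonneg[OF _ jV] S by (intro sum.cong) (auto simp: abs_mult)
    finally show ?thesis using fin j by (simp add: sum.remove)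
  qed
  have drift: "(\<Sum>j\<in>S. Q i j * u j) < 0" if i: "i \<in> S" for i
  proof -
    have "0 \<le> (\<Sum>j\<in>V - S. Q i j * u j)"
      using i S rate_nonneg[of i] u by (intro sum_nonneg mult_nonneg_nonneg) auto
    moreover have "(\<Sum>j\<in>V. Q i j * u j) = (\<Sum>j\<in>V - S. Q i j * u j) + (\<Sum>j\<in>S. Q i j * u j)"
      using S finite_states by (intro sum.subset_diff) auto
    moreover have "i \<in> V - {c}" using i S by auto
    ultimately show ?thesis using u(2)[of i] by linarith
  qed
  have "0 \<le> (\<Sum>j\<in>S. (\<Sum>i\<in>S. \<bar>z i\<bar> * Q i j) * u j)"
  proof (rule sum_nonneg)
    fix j assume j: "j \<in> S"
    then have "0 \<le> u j" using u(1) S by auto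
    then show "0 \<le> (\<Sum>i\<in>S. \<bar>z i\<bar> * Q i j) * u j" using inflow[OF j] by (rule mult_nonneg_nonneg[rotated])
  qed
  also have "\<dots> = (\<Sum>i\<in>S. \<bar>z i\<bar> * (\<Sum>j\<in>S. Q i j * u j))"
    by (simp add: sum_distrib_left sum_distrib_right mult.assoc) (rule sum.swap)
  finally have "(\<Sum>i\<in>S. - (\<bar>z i\<bar> * (\<Sum>j\<in>S. Q i j * u j))) \<le> 0" by (simp add: sum_negf)
  moreover have nonneg: "0 \<le> - (\<bar>z i\<bar> * (\<Sum>j\<in>S. Q i j * u j))" if "i \<in> S" for i
    using drift[OF that] by (simp add: mult_nonneg_nonpos)
  ultimately have "(\<Sum>i\<in>S. - (\<bar>z i\<bar> * (\<Sum>j\<in>S. Q i j * u j))) = 0"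
    by (intro order_antisym sum_nonneg) auto
  then have "- (\<bar>z i\<bar> * (\<Sum>j\<in>S. Q i j * u j)) = 0"
    by (intro sum_nonneg_0[OF fin _ _ i, where f = "\<lambda>i. - (\<bar>z i\<bar> * (\<Sum>j\<in>S. Q i j * u j))"] nonneg)
  then show "z i = 0" using drift[OF i] by simp
qed

end

section \<open>Excursions on the grid\<close>

text \<open>For a sequence starting in \<open>e\<close>: neither has \<open>c\<close> been visited nor has the sequence
  come back to \<open>e\<close> after leaving it.\<close>

definition unfinished :: "int \<Rightarrow> int \<Rightarrow> (nat \<Rightarrow> int) \<Rightarrow> nat \<Rightarrow> bool" where
  "unfinished e c f m \<longleftrightarrow> (\<forall>k\<le>m. f k \<noteq> c \<and> (\<forall>l<k. f l \<noteq> e \<longrightarrow> f k \<noteq> e))"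

lemma unfinished_cong:
  assumes "\<And>k. k \<le> m \<Longrightarrow> f k = g k"
  shows "unfinished e c f m = unfinished e c g m"
  unfolding unfinished_def
  by (intro all_cong conj_cong) (use assms in auto)

lemma unfinished_Suc:
  "unfinished e c f (Suc m) \<longleftrightarrow>
     unfinished e c f m \<and> f (Suc m) \<noteq> c \<and> (f (Suc m) = e \<longrightarrow> (\<forall>l\<le>m. f l = e))"
  unfolding unfinished_def by (auto simp: le_Suc_eq less_Suc_eq_le)

lemma unfinished_mono: "unfinished e c f m \<Longrightarrow> k \<le> m \<Longrightarrow> unfinished e c f k"
  unfolding unfinished_def by auto

lemma unfinished_not_target: "unfinished e c f m \<Longrightarrow> f m \<noteq> c"
  unfolding unfinished_def by auto

lemma unfinished_at_start:
  assumes "unfinished e c f m" "f m = e" "l \<le> m"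
  shows "f l = e"
  using assms unfolding unfinished_def by (metis le_neq_implies_less order_refl)

lemma unfinished_subsequence:
  assumes "unfinished e c f m" "k * N \<le> m" "0 < N"
  shows "unfinished e c (\<lambda>l. f (l * N)) k"
  unfolding unfinished_def
proof (intro allI impI conjI)
  fix l assume "l \<le> k"
  then have l: "l * N \<le> m" using assms(2) by (meson le_trans mult_le_mono1)
  then show "f (l * N) \<noteq> c" using assms(1) unfolding unfinished_def by blast
  fix i assume "i < l" "f (i * N) \<noteq> e"
  then show "f (l * N) \<noteq> e" using assms(1,3) l unfolding unfinished_def
    by (metis mult_less_mono1)
qed

locale excursion = irreducible_ctmc +
  fixes e c :: int
  assumes start_state: "e \<in> V" and target_state: "c \<in> V" and start_target_neq: "e \<noteq> c"
begin

definition grid_visit :: "real \<Rightarrow> nat \<Rightarrow> int \<Rightarrow> real" where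
  "grid_visit d m i = \<P>(\<omega> in M e. unfinished e c (grid d \<omega>) m \<and> grid d \<omega> m = i)"

definition grid_hit :: "real \<Rightarrow> nat \<Rightarrow> real" where
  "grid_hit d m = \<P>(\<omega> in M e. unfinished e c (grid d \<omega>) m \<and> grid d \<omega> (Suc m) = c)"

lemma prob_space_start: "prob_space (M e)"
  by (rule prob_space[OF start_state])

lemma grid_event:
  assumes "0 < d"
  shows "{\<omega> \<in> space (M e). unfinished e c (grid d \<omega>) m \<and> grid d \<omega> l \<in> A \<and> grid d \<omega> k \<in> B} \<in> sets (M e)"
proof (rule prefix_event[where m = "max m (max l k)" and A = "\<lambda>f. unfinished e c f m \<and> f l \<in> A \<and> f k \<in> B", OF start_state])
  show "0 \<le> d" using assms by simp
  fix f g :: "nat \<Rightarrow> int" assume h: "\<And>j. j \<le> max m (max l k) \<Longrightarrow> f j = g j"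
  have "unfinished e c f m = unfinished e c g m" by (rule unfinished_cong) (simp add: h)
  then show "(unfinished e c f m \<and> f l \<in> A \<and> f k \<in> B) = (unfinished e c g m \<and> g l \<in> A \<and> g k \<in> B)"
    using h[of l] h[of k] by simp
qed

lemma AE_grid_start: "AE \<omega> in M e. grid d \<omega> 0 = e"
  using start[OF start_state] by (simp add: grid_def)

lemma grid_visit_nonneg: "0 \<le> grid_visit d m i"
  by (simp add: grid_visit_def)

lemma grid_one_step:
  assumes d: "0 < d" and j: "j \<in> V"
  shows "\<P>(\<omega> in M e. unfinished e c (grid d \<omega>) m \<and> grid d \<omega> (Suc m) = j)
       = (\<Sum>i\<in>V - {c}. grid_visit d m i * trans_prob d i j)"
proof -
  interpret prob_space "M e" by (rule prob_space_start)
  have "\<P>(\<omega> in M e. unfinished e c (grid d \<omega>) m \<and> grid d \<omega> (Suc m) = j)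
      = (\<Sum>i\<in>V - {c}. \<P>(\<omega> in M e. unfinished e c (grid d \<omega>) m \<and> grid d \<omega> m = i \<and> grid d \<omega> (Suc m) = j))"
  proof (rule prob_sum)
    show "finite (V - {c})" using finite_states by simp
    show "{\<omega> \<in> space (M e). unfinished e c (grid d \<omega>) m \<and> grid d \<omega> m = i \<and> grid d \<omega> (Suc m) = j} \<in> events" for i
      using grid_event[OF d, of m m "{i}" "Suc m" "{j}"] by simp
    show "{\<omega> \<in> space (M e). unfinished e c (grid d \<omega>) m \<and> grid d \<omega> (Suc m) = j} \<in> events"
      using grid_event[OF d, of m m UNIV "Suc m" "{j}"] by simp
    show "AE \<omega> in M e.
        (\<forall>i\<in>V - {c}. unfinished e c (grid d \<omega>) m \<and> grid d \<omega> m = i \<and> grid d \<omega> (Suc m) = j \<longrightarrow>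
            unfinished e c (grid d \<omega>) m \<and> grid d \<omega> (Suc m) = j) \<and>
        (unfinished e c (grid d \<omega>) m \<and> grid d \<omega> (Suc m) = j \<longrightarrow>
            (\<exists>!i\<in>V - {c}. unfinished e c (grid d \<omega>) m \<and> grid d \<omega> m = i \<and> grid d \<omega> (Suc m) = j))"
    proof (rule AE_I2)
      fix \<omega> assume w: "\<omega> \<in> space (M e)"
      have "grid d \<omega> m \<in> V" using grid_in_states[OF start_state w] d by simp
      then show "(\<forall>i\<in>V - {c}. unfinished e c (grid d \<omega>) m \<and> grid d \<omega> m = i \<and> grid d \<omega> (Suc m) = j \<longrightarrow>
            unfinished e c (grid d \<omega>) m \<and> grid d \<omega> (Suc m) = j) \<and>
        (unfinished e c (grid d \<omega>) m \<and> grid d \<omega> (Suc m) = j \<longrightarrow>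
            (\<exists>!i\<in>V - {c}. unfinished e c (grid d \<omega>) m \<and> grid d \<omega> m = i \<and> grid d \<omega> (Suc m) = j))"
        using unfinished_not_target[of e c "grid d \<omega>" m] by auto
    qed
  qed
  also have "\<dots> = (\<Sum>i\<in>V - {c}. grid_visit d m i * trans_prob d i j)"
  proof (rule sum.cong[OF refl])
    fix i assume "i \<in> V - {c}"
    then have "i \<in> V" by simp
    show "\<P>(\<omega> in M e. unfinished e c (grid d \<omega>) m \<and> grid d \<omega> m = i \<and> grid d \<omega> (Suc m) = j)
        = grid_visit d m i * trans_prob d i j"
      unfolding grid_visit_def
      by (rule grid_markov[OF start_state d \<open>i \<in> V\<close> j, of m "\<lambda>f. unfinished e c f m"])
        (rule unfinished_cong)
  qed
  finally show ?thesis .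
qed

lemma grid_hit_eq:
  "0 < d \<Longrightarrow> grid_hit d m = (\<Sum>i\<in>V - {c}. grid_visit d m i * trans_prob d i c)"
  unfolding grid_hit_def by (rule grid_one_step[OF _ target_state])

lemma grid_visit_Suc_le:
  assumes d: "0 < d" and j: "j \<in> V"
  shows "grid_visit d (Suc m) j \<le> (\<Sum>i\<in>V - {c}. grid_visit d m i * trans_prob d i j)"
proof -
  interpret prob_space "M e" by (rule prob_space_start)
  have "{\<omega> \<in> space (M e). unfinished e c (grid d \<omega>) m \<and> grid d \<omega> (Suc m) = j} \<in> events"
    using grid_event[OF d, of m m UNIV "Suc m" "{j}"] by simp
  then have "grid_visit d (Suc m) j
      \<le> \<P>(\<omega> in M e. unfinished e c (grid d \<omega>) m \<and> grid d \<omega> (Suc m) = j)"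
    unfolding grid_visit_def by (intro finite_measure_mono) (auto simp: unfinished_Suc)
  then show ?thesis by (simp only: grid_one_step[OF d j])
qed

lemma grid_visit_Suc:
  assumes d: "0 < d" and j: "j \<in> V - {e, c}"
  shows "grid_visit d (Suc m) j = (\<Sum>i\<in>V - {c}. grid_visit d m i * trans_prob d i j)"
proof -
  have "j \<in> V" using j by simp
  have "unfinished e c (grid d \<omega>) (Suc m) \<and> grid d \<omega> (Suc m) = j \<longleftrightarrow>
      unfinished e c (grid d \<omega>) m \<and> grid d \<omega> (Suc m) = j" for \<omega>
    using j by (auto simp: unfinished_Suc)
  then have "grid_visit d (Suc m) j
      = \<P>(\<omega> in M e. unfinished e c (grid d \<omega>) m \<and> grid d \<omega> (Suc m) = j)"
    unfolding grid_visit_def by (simp only:)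
  then show ?thesis by (simp only: grid_one_step[OF d \<open>j \<in> V\<close>])
qed

lemma grid_visit_0: "0 < d \<Longrightarrow> grid_visit d 0 j = of_bool (j = e)"
proof -
  assume d: "0 < d"
  interpret prob_space "M e" by (rule prob_space_start)
  have ev: "{\<omega> \<in> space (M e). unfinished e c (grid d \<omega>) 0 \<and> grid d \<omega> 0 = j} \<in> events"
    using grid_event[OF d, of 0 0 UNIV 0 "{j}"] by simp
  show ?thesis
  proof (cases "j = e")
    case True
    have "AE \<omega> in M e. unfinished e c (grid d \<omega>) 0 \<and> grid d \<omega> 0 = j"
      using AE_grid_start[of d] start_target_neq True
      by (auto simp: unfinished_def elim: eventually_mono)
    then show ?thesis using prob_Collect_eq_1[OF ev] True by (simp add: grid_visit_def)
  next
    case False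
    have "AE \<omega> in M e. \<not> (unfinished e c (grid d \<omega>) 0 \<and> grid d \<omega> 0 = j)"
      using AE_grid_start[of d] False by (auto elim: eventually_mono)
    then show ?thesis using prob_Collect_eq_0[OF ev] False by (simp add: grid_visit_def)
  qed
qed

text \<open>The excursion can be at \<open>e\<close> only if it has not left \<open>e\<close> yet.\<close>

lemma grid_visit_start: "0 < d \<Longrightarrow> grid_visit d m e = trans_prob d e e ^ m"
proof (induction m)
  case 0 then show ?case by (simp add: grid_visit_0)
next
  case (Suc m)
  note d = Suc.prems
  interpret prob_space "M e" by (rule prob_space_start)
  have "AE \<omega> in M e. (unfinished e c (grid d \<omega>) (Suc m) \<and> grid d \<omega> (Suc m) = e) =
     (unfinished e c (grid d \<omega>) m \<and> grid d \<omega> m = e \<and> grid d \<omega> (Suc m) = e)"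
    using AE_grid_start[of d]
  proof eventually_elim
    case (elim \<omega>)
    then show ?case
      using unfinished_at_start[of e c "grid d \<omega>" m] start_target_neq
      by (auto simp: unfinished_Suc)
  qed
  then have "grid_visit d (Suc m) e
      = \<P>(\<omega> in M e. unfinished e c (grid d \<omega>) m \<and> grid d \<omega> m = e \<and> grid d \<omega> (Suc m) = e)"
    unfolding grid_visit_def
    using grid_event[OF d, of "Suc m" m UNIV "Suc m" "{e}"]
      grid_event[OF d, of m m "{e}" "Suc m" "{e}"]
    by (intro prob_eq_AE) simp_all
  also have "\<dots> = grid_visit d m e * trans_prob d e e"
    unfolding grid_visit_def
    by (rule grid_markov[OF start_state d start_state start_state, of m "\<lambda>f. unfinished e c f m"])
      (rule unfinished_cong)
  finally show ?case using Suc by simp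
qed

text \<open>On a fine grid the discrete chain inherits the strict drift of the Lyapunov function.
  Summing the resulting decrements bounds the expected number of visits.\<close>

lemma summable_grid_visit:
  "\<forall>\<^sub>F d in at_right 0. 0 < d \<and> (\<forall>i\<in>V - {c}. summable (\<lambda>m. grid_visit d m i))"
proof -
  obtain u where u: "\<And>i. i \<in> V \<Longrightarrow> 0 \<le> u i" "\<And>i. i \<in> V - {c} \<Longrightarrow> (\<Sum>j\<in>V. Q i j * u j) < 0"
    using lyapunov_function[OF target_state] by blast
  define G where "G d i = u i - (\<Sum>j\<in>V. trans_prob d i j * u j)" for d i
  have ev: "\<forall>\<^sub>F d in at_right 0. \<forall>i\<in>V - {c}. (\<Sum>j\<in>V. (trans_prob d i j - of_bool (i = j)) / d * u j) < 0"
  proof (rule eventually_ball_finite)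
    show "finite (V - {c})" using finite_states by simp
    show "\<forall>i\<in>V - {c}. \<forall>\<^sub>F d in at_right 0. (\<Sum>j\<in>V. (trans_prob d i j - of_bool (i = j)) / d * u j) < 0"
    proof
      fix i assume i: "i \<in> V - {c}"
      have "((\<lambda>d. \<Sum>j\<in>V. (trans_prob d i j - of_bool (i = j)) / d * u j) \<longlongrightarrow> (\<Sum>j\<in>V. Q i j * u j)) (at_right 0)"
        using i by (intro tendsto_sum tendsto_mult_right trans_prob_derivative) auto
      then show "\<forall>\<^sub>F d in at_right 0. (\<Sum>j\<in>V. (trans_prob d i j - of_bool (i = j)) / d * u j) < 0"
        by (rule order_tendstoD(2)) (rule u(2)[OF i])
    qed
  qed
  show ?thesis
    using ev eventually_at_right_less[of "0::real"]
  proof eventually_elim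
    case (elim d)
    then have d: "0 < d" by simp
    have G: "0 < G d i" if i: "i \<in> V - {c}" for i
    proof -
      have "(\<Sum>j\<in>V. of_bool (i = j) * u j) = u i"
        using i finite_states by (simp add: of_bool_def if_distrib[of "\<lambda>b. b * _"] cong: if_cong)
      then have "(\<Sum>j\<in>V. (trans_prob d i j - of_bool (i = j)) / d * u j) = - G d i / d"
        by (simp add: G_def sum_subtractf left_diff_distrib diff_divide_distrib sum_divide_distrib[symmetric])
      then have "- G d i / d < 0" using bspec[OF elim(1) i] by (simp only:)
      then show ?thesis using d by (simp add: zero_less_divide_iff)
    qed
    define U where "U m = (\<Sum>i\<in>V - {c}. grid_visit d m i * u i)" for m
    have U_nonneg: "0 \<le> U m" for m
      unfolding U_def using u(1) by (intro sum_nonneg mult_nonneg_nonneg grid_visit_nonneg) auto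
    have decrease: "U (Suc m) \<le> U m - (\<Sum>i\<in>V - {c}. grid_visit d m i * G d i)" for m
    proof -
      have "U (Suc m) \<le> (\<Sum>j\<in>V - {c}. (\<Sum>i\<in>V - {c}. grid_visit d m i * trans_prob d i j) * u j)"
        unfolding U_def using u(1) grid_visit_Suc_le[OF d] by (intro sum_mono mult_right_mono) auto
      also have "\<dots> \<le> (\<Sum>j\<in>V. (\<Sum>i\<in>V - {c}. grid_visit d m i * trans_prob d i j) * u j)"
        using u(1) finite_states
        by (intro sum_mono2 mult_nonneg_nonneg sum_nonneg grid_visit_nonneg trans_prob_nonneg) auto
      also have "\<dots> = (\<Sum>i\<in>V - {c}. grid_visit d m i * (\<Sum>j\<in>V. trans_prob d i j * u j))"
        by (simp add: sum_distrib_left sum_distrib_right mult.assoc) (rule sum.swap)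
      also have "\<dots> = U m - (\<Sum>i\<in>V - {c}. grid_visit d m i * G d i)"
        by (simp add: U_def G_def right_diff_distrib sum_subtractf)
      finally show ?thesis .
    qed
    have total: "(\<Sum>l<m. \<Sum>i\<in>V - {c}. grid_visit d l i * G d i) \<le> U 0 - U m" for m
    proof (induction m)
      case (Suc m) then show ?case using decrease[of m] by simp
    qed simp
    have "summable (\<lambda>m. grid_visit d m i)" if i: "i \<in> V - {c}" for i
    proof (rule summableI_nonneg_bounded[where x = "U 0 / G d i"])
      fix m
      have "(\<Sum>l<m. grid_visit d l i) * G d i = (\<Sum>l<m. grid_visit d l i * G d i)"
        by (simp add: sum_distrib_right)
      also have "\<dots> \<le> (\<Sum>l<m. \<Sum>i\<in>V - {c}. grid_visit d l i * G d i)"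
        using i finite_states less_imp_le[OF G]
        by (intro sum_mono member_le_sum mult_nonneg_nonneg grid_visit_nonneg) auto
      also have "\<dots> \<le> U 0" using total[of m] U_nonneg[of m] by simp
      finally show "(\<Sum>l<m. grid_visit d l i) \<le> U 0 / G d i" using G[OF i] by (simp add: field_simps)
    qed (rule grid_visit_nonneg)
    with d show ?case by simp
  qed
qed

definition grid_visits :: "real \<Rightarrow> int \<Rightarrow> real" where
  "grid_visits d i = (\<Sum>m. grid_visit d m i)"

context
  fixes d :: real
  assumes d: "0 < d" and summable: "\<forall>i\<in>V - {c}. summable (\<lambda>m. grid_visit d m i)"
begin

lemma grid_visits_start: "grid_visits d e * (1 - trans_prob d e e) = 1"
proof -
  have "summable (\<lambda>m. trans_prob d e e ^ m)"
    using bspec[OF summable, of e] start_state start_target_neq by (simp add: grid_visit_start[OF d])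
  then have "norm (trans_prob d e e) < 1" by (simp add: summable_geometric_iff)
  then show ?thesis
    using suminf_geometric[of "trans_prob d e e"] by (simp add: grid_visits_def grid_visit_start[OF d])
qed

lemma sums_grid_step:
  "(\<lambda>m. \<Sum>i\<in>V - {c}. grid_visit d m i * trans_prob d i j) sums
     (\<Sum>i\<in>V - {c}. grid_visits d i * trans_prob d i j)"
  using summable unfolding grid_visits_def by (intro sums_sum sums_mult2 summable_sums) auto

text \<open>Every visit to \<open>j\<close> is preceded by a visit within the same excursion, since the excursion
  starts in another state.\<close>

lemma grid_visits_balance:
  assumes j: "j \<in> V - {e, c}"
  shows "grid_visits d j = (\<Sum>i\<in>V - {c}. grid_visits d i * trans_prob d i j)"
proof -
  have "(\<Sum>m. grid_visit d (Suc m) j) = grid_visits d j - grid_visit d 0 j"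
    unfolding grid_visits_def using summable j by (intro suminf_split_head) auto
  moreover have "(\<Sum>m. grid_visit d (Suc m) j) = (\<Sum>i\<in>V - {c}. grid_visits d i * trans_prob d i j)"
    unfolding grid_visit_Suc[OF d j] by (rule sums_unique[OF sums_grid_step, symmetric])
  ultimately show ?thesis using j by (simp add: grid_visit_0[OF d])
qed

lemma grid_hit_prob:
  "\<P>(\<omega> in M e. \<exists>m. unfinished e c (grid d \<omega>) m \<and> grid d \<omega> (Suc m) = c)
     = (\<Sum>i\<in>V - {c}. grid_visits d i * trans_prob d i c)"
proof -
  interpret prob_space "M e" by (rule prob_space_start)
  have ev: "{\<omega> \<in> space (M e). unfinished e c (grid d \<omega>) m \<and> grid d \<omega> (Suc m) = c} \<in> events" for m
    using grid_event[OF d, of m m UNIV "Suc m" "{c}"] by simp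
  have uniq: "m = n" if "unfinished e c f m" "f (Suc m) = c" "unfinished e c f n" "f (Suc n) = c"
    for m n and f :: "nat \<Rightarrow> int"
    using that unfolding unfinished_def by (metis Suc_leI linorder_neqE_nat)
  have "(\<lambda>m. grid_hit d m) sums
      \<P>(\<omega> in M e. \<exists>m. unfinished e c (grid d \<omega>) m \<and> grid d \<omega> (Suc m) = c)"
    unfolding grid_hit_def
  proof (rule prob_sums[OF ev])
    have "{\<omega> \<in> space (M e). \<exists>m. unfinished e c (grid d \<omega>) m \<and> grid d \<omega> (Suc m) = c}
      = (\<Union>m. {\<omega> \<in> space (M e). unfinished e c (grid d \<omega>) m \<and> grid d \<omega> (Suc m) = c})" by auto
    then show "{\<omega> \<in> space (M e). \<exists>m. unfinished e c (grid d \<omega>) m \<and> grid d \<omega> (Suc m) = c} \<in> events"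
      using ev by (simp add: sets.countable_UN)
    show "AE \<omega> in M e.
        (\<forall>m. unfinished e c (grid d \<omega>) m \<and> grid d \<omega> (Suc m) = c \<longrightarrow>
            (\<exists>m. unfinished e c (grid d \<omega>) m \<and> grid d \<omega> (Suc m) = c)) \<and>
        ((\<exists>m. unfinished e c (grid d \<omega>) m \<and> grid d \<omega> (Suc m) = c) \<longrightarrow>
            (\<exists>!m. unfinished e c (grid d \<omega>) m \<and> grid d \<omega> (Suc m) = c))"
      using uniq by (intro AE_I2 conjI allI impI) blast+
  qed
  then show ?thesis
    using sums_unique2[OF _ sums_grid_step[of c]] by (simp add: grid_hit_eq[OF d])
qed

end

end

section \<open>Hitting times of a right-continuous path and of its grid values\<close>

definition mesh :: "nat \<Rightarrow> real" where
  "mesh n = (1 / 2) ^ n"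

definition next_index :: "real \<Rightarrow> real \<Rightarrow> nat" where
  "next_index d t = Suc (nat \<lfloor>t / d\<rfloor>)"

definition next_point :: "nat \<Rightarrow> real \<Rightarrow> real" where
  "next_point n t = real (next_index (mesh n) t) * mesh n"

text \<open>The times over which the infimum in the hitting time of \<open>a\<close> is taken.\<close>

definition hit_set :: "(real \<Rightarrow> int) \<Rightarrow> int \<Rightarrow> real set" where
  "hit_set x a = (if x 0 = a then {t. 0 < t \<and> (\<exists>u\<in>{0<..<t}. x u \<noteq> a \<and> x t = a)}
                  else {t. 0 < t \<and> x t = a})"

lemma hitting_time_eq: "hitting_time X a \<omega> = Inf (ereal ` hit_set (\<lambda>t. X t \<omega>) a)"
  unfolding hitting_time_def hit_set_def by (auto intro!: arg_cong[of _ _ Inf])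

lemma mesh_pos: "0 < mesh n"
  by (simp add: mesh_def)

lemma mesh_tendsto: "mesh \<longlonglongrightarrow> 0"
  unfolding mesh_def by (rule LIMSEQ_realpow_zero) auto

lemma mesh_at_right: "filterlim mesh (at_right 0) sequentially"
proof -
  have "\<forall>n. mesh n \<in> {0<..} \<and> mesh n \<noteq> 0" using mesh_pos by (metis greaterThan_iff less_irrefl)
  then show ?thesis using mesh_tendsto by (auto simp: filterlim_at)
qed

lemma next_point_bounds:
  assumes "0 \<le> t"
  shows "t < next_point n t" "next_point n t \<le> t + mesh n"
proof -
  have nonneg: "0 \<le> \<lfloor>t / mesh n\<rfloor>" using assms mesh_pos[of n] by simp
  then have eq: "next_point n t = (of_int \<lfloor>t / mesh n\<rfloor> + 1) * mesh n"
    by (simp add: next_point_def next_index_def)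
  have "t / mesh n < of_int \<lfloor>t / mesh n\<rfloor> + 1" by linarith
  then show "t < next_point n t" using mesh_pos[of n] unfolding eq by (simp add: field_simps)
  have "of_int \<lfloor>t / mesh n\<rfloor> * mesh n \<le> t"
    by (rule pos_le_divide_eq[OF mesh_pos, THEN iffD1]) (rule of_int_floor_le)
  then show "next_point n t \<le> t + mesh n" unfolding eq by (simp add: algebra_simps)
qed

lemma next_index_mono:
  assumes "t \<le> u"
  shows "next_index (mesh n) t \<le> next_index (mesh n) u"
proof -
  have "t / mesh n \<le> u / mesh n" using assms mesh_pos[of n] by (simp add: divide_right_mono)
  then show ?thesis unfolding next_index_def by (intro Suc_le_mono[THEN iffD2] nat_mono floor_mono)
qed

lemma mesh_add: "2 ^ n * mesh (n0 + n) = mesh n0"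
  by (simp add: mesh_def power_add power_divide)

lemma coarse_index_le:
  assumes "0 \<le> t"
  shows "nat \<lfloor>t / mesh n0\<rfloor> * 2 ^ n \<le> nat \<lfloor>t / mesh (n0 + n)\<rfloor>"
proof -
  have "of_int \<lfloor>t / mesh n0\<rfloor> * 2 ^ n \<le> (t / mesh n0) * 2 ^ n"
    by (intro mult_right_mono of_int_floor_le) simp
  also have "\<dots> = t / mesh (n0 + n)"
    using mesh_add[of n n0] mesh_pos[of n0] mesh_pos[of "n0 + n"] by (auto simp: field_simps)
  finally have "\<lfloor>t / mesh n0\<rfloor> * 2 ^ n \<le> \<lfloor>t / mesh (n0 + n)\<rfloor>"
    by (simp add: le_floor_iff)
  then have "nat (\<lfloor>t / mesh n0\<rfloor> * 2 ^ n) \<le> nat \<lfloor>t / mesh (n0 + n)\<rfloor>" by (rule nat_mono)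
  then show ?thesis using assms mesh_pos[of n0] by (simp add: nat_mult_distrib nat_power_eq)
qed

lemma hit_set_pos: "t \<in> hit_set x a \<Longrightarrow> 0 < t"
  by (auto simp: hit_set_def split: if_splits)

lemma hit_set_value: "t \<in> hit_set x a \<Longrightarrow> x t = a"
  by (auto simp: hit_set_def split: if_splits)

locale right_continuous_path =
  fixes x :: "real \<Rightarrow> int"
  assumes right_cont: "0 \<le> t \<Longrightarrow> \<forall>\<^sub>F u in at_right t. x u = x t"
begin

lemma constant_right:
  assumes "0 \<le> t"
  obtains r where "0 < r" "\<And>u. t \<le> u \<Longrightarrow> u < t + r \<Longrightarrow> x u = x t"
proof -
  obtain b where b: "t < b" "\<And>u. t < u \<Longrightarrow> u < b \<Longrightarrow> x u = x t"
    using right_cont[OF assms] by (auto simp: eventually_at_right_field)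
  show ?thesis
  proof (rule that[of "b - t"])
    fix u assume "t \<le> u" "u < t + (b - t)"
    then show "x u = x t" using b(2)[of u] by (cases "u = t") auto
  qed (use b in simp)
qed

lemma eventually_next_point_less:
  assumes "0 \<le> t" "t < b"
  shows "\<forall>\<^sub>F n in sequentially. next_point n t < b"
proof -
  have "\<forall>\<^sub>F n in sequentially. mesh n < b - t"
    using assms by (intro order_tendstoD(2)[OF mesh_tendsto]) simp
  then show ?thesis
  proof eventually_elim
    case (elim n)
    then show ?case using next_point_bounds(2)[OF assms(1), of n] by linarith
  qed
qed

lemma eventually_next_point_value:
  assumes "0 \<le> t"
  shows "\<forall>\<^sub>F n in sequentially. x (next_point n t) = x t"
proof -
  obtain r where r: "0 < r" "\<And>u. t \<le> u \<Longrightarrow> u < t + r \<Longrightarrow> x u = x t"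
    using constant_right[OF assms] by blast
  have "\<forall>\<^sub>F n in sequentially. next_point n t < t + r"
    using r by (intro eventually_next_point_less assms) simp
  then show ?thesis
    by eventually_elim (use next_point_bounds(1)[OF assms] r(2) in \<open>auto intro: less_imp_le\<close>)
qed

text \<open>Equivalently, a nonempty hit set contains its infimum.\<close>

lemma no_hit_extends:
  assumes t: "0 \<le> t" and none: "hit_set x a \<inter> {..t} = {}"
  obtains r where "t < r" "hit_set x a \<inter> {..<r} = {}"
proof -
  obtain q where q: "0 < q" "\<And>u. t \<le> u \<Longrightarrow> u < t + q \<Longrightarrow> x u = x t"
    using constant_right[OF t] by blast
  have "s \<notin> hit_set x a" if s: "s < t + q" for s
  proof
    assume hit: "s \<in> hit_set x a"
    then have ts: "t < s" using none by force
    then have "x t = a" using q(2)[of s] s hit_set_value[OF hit] by simp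
    show False
    proof (cases "x 0 = a")
      case False
      then have "0 < t" using \<open>x t = a\<close> t by (cases "t = 0") auto
      then have "t \<in> hit_set x a" using False \<open>x t = a\<close> by (simp add: hit_set_def)
      then show False using none by auto
    next
      case True
      then obtain u where u: "0 < u" "u < s" "x u \<noteq> a" using hit by (auto simp: hit_set_def)
      have "u < t" using q(2)[of u] u s \<open>x t = a\<close> by (cases "u < t") auto
      then have "t \<in> hit_set x a" using True u \<open>x t = a\<close> by (auto simp: hit_set_def)
      then show False using none by auto
    qed
  qed
  with q(1) that[of "t + q"] show ?thesis by auto
qed

lemma less_hitting_iff:
  assumes t: "0 \<le> t"
  shows "ereal t < Inf (ereal ` hit_set x a) \<longleftrightarrow> hit_set x a \<inter> {..t} = {}"
proof
  assume less: "ereal t < Inf (ereal ` hit_set x a)"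
  have "t < s" if "s \<in> hit_set x a" for s
    using less_le_trans[OF less Inf_lower[of "ereal s"]] that by auto
  then show "hit_set x a \<inter> {..t} = {}" by force
next
  assume "hit_set x a \<inter> {..t} = {}"
  then obtain r where r: "t < r" "hit_set x a \<inter> {..<r} = {}" using no_hit_extends[OF t] by blast
  have "ereal r \<le> Inf (ereal ` hit_set x a)" using r(2) by (intro Inf_greatest) (auto simp: not_less[symmetric])
  then show "ereal t < Inf (ereal ` hit_set x a)" using r(1) by (auto intro: less_le_trans[of _ "ereal r"])
qed

text \<open>Both infima are attained by right-continuity, so two different states cannot be hit for
  the first time at the same finite time.\<close>

lemma hitting_times_neq:
  assumes "a \<noteq> b" "hit_set x a \<union> hit_set x b \<noteq> {}"
  shows "Inf (ereal ` hit_set x a) \<noteq> Inf (ereal ` hit_set x b)"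
proof
  assume eq: "Inf (ereal ` hit_set x a) = Inf (ereal ` hit_set x b)"
  let ?I = "Inf (ereal ` hit_set x a)"
  have nonneg: "0 \<le> ?I"
    by (rule Inf_greatest) (auto simp: less_imp_le hit_set_pos)
  obtain s where "s \<in> hit_set x a \<or> s \<in> hit_set x b" using assms(2) by auto
  then have "?I \<le> ereal s" using eq by (metis Inf_lower imageI)
  then obtain i where i: "?I = ereal i" using nonneg by (cases ?I) auto
  then have "0 \<le> i" using nonneg by simp
  then obtain q where q: "0 < q" "\<And>u. i \<le> u \<Longrightarrow> u < i + q \<Longrightarrow> x u = x i"
    using constant_right by blast
  have val: "x i = y" if inf: "Inf (ereal ` hit_set x y) = ereal i" for y
  proof -
    have "Inf (ereal ` hit_set x y) < ereal (i + q)" using inf q by simp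
    then obtain h where h: "h \<in> hit_set x y" "h < i + q" by (auto simp: Inf_less_iff)
    have "Inf (ereal ` hit_set x y) \<le> ereal h" using h by (intro Inf_lower) auto
    then have "i \<le> h" using inf by simp
    then show ?thesis using q(2)[of h] h hit_set_value[OF h(1)] by simp
  qed
  show False using val[of a] val[of b] i eq assms(1) by simp
qed

end

locale excursion_path = right_continuous_path +
  fixes e c :: int
  assumes path_start: "x 0 = e" and neq: "e \<noteq> c"
begin

abbreviation grid_path :: "nat \<Rightarrow> nat \<Rightarrow> int" where
  "grid_path n l \<equiv> x (real l * mesh n)"

abbreviation endings :: "real set" where
  "endings \<equiv> hit_set x e \<union> hit_set x c"

lemma finished_on_grid:
  assumes "\<not> unfinished e c (grid_path n) m"
  obtains l where "l \<le> m" "real l * mesh n \<in> endings"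
proof -
  obtain k where k: "k \<le> m"
    and cases: "grid_path n k = c \<or> (\<exists>l<k. grid_path n l \<noteq> e \<and> grid_path n k = e)"
    using assms by (auto simp: unfinished_def)
  from cases have "real k * mesh n \<in> endings"
  proof
    assume "grid_path n k = c"
    moreover from this have "k \<noteq> 0" using path_start neq by (intro notI) auto
    ultimately show ?thesis using path_start neq mesh_pos[of n] by (simp add: hit_set_def)
  next
    assume "\<exists>l<k. grid_path n l \<noteq> e \<and> grid_path n k = e"
    then obtain l where l: "l < k" "grid_path n l \<noteq> e" "grid_path n k = e" by auto
    then have "l \<noteq> 0" using path_start by (intro notI) auto
    then have "real l * mesh n \<in> {0<..<real k * mesh n}" using l mesh_pos[of n] by simp
    then show ?thesis using l path_start mesh_pos[of n] by (auto simp: hit_set_def intro!: bexI[of _ "real l * mesh n"])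
  qed
  with k that show ?thesis by blast
qed

lemma eventually_return_on_grid:
  assumes "h \<in> hit_set x e"
  shows "\<forall>\<^sub>F n in sequentially. x (next_point n h) = e \<and>
    (\<exists>l<next_index (mesh n) h. grid_path n l \<noteq> e)"
proof -
  obtain u where u: "0 < u" "u < h" "x u \<noteq> e"
    using assms path_start by (auto simp: hit_set_def)
  have h: "0 < h" "x h = e" using hit_set_pos[OF assms] hit_set_value[OF assms] by auto
  have "\<forall>\<^sub>F n in sequentially. x (next_point n h) = x h" "\<forall>\<^sub>F n in sequentially. x (next_point n u) = x u"
    "\<forall>\<^sub>F n in sequentially. next_point n u < h"
    using u h by (intro eventually_next_point_value eventually_next_point_less; simp)+
  then show ?thesis
  proof eventually_elim
    case (elim n)
    have "next_point n u < next_point n h"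
      using elim(3) next_point_bounds(1)[of h n] h by simp
    then have "next_index (mesh n) u < next_index (mesh n) h"
      using mesh_pos[of n] by (simp add: next_point_def)
    then show ?case using elim h u by (auto simp: next_point_def)
  qed
qed

lemma eventually_finished:
  assumes "h \<in> endings"
  shows "\<forall>\<^sub>F n in sequentially. \<not> unfinished e c (grid_path n) (next_index (mesh n) h)"
  using assms
proof
  assume h: "h \<in> hit_set x e"
  show ?thesis
    using eventually_return_on_grid[OF h]
    by eventually_elim (auto simp: unfinished_def next_point_def)
next
  assume h: "h \<in> hit_set x c"
  have "\<forall>\<^sub>F n in sequentially. x (next_point n h) = x h"
    using hit_set_pos[OF h] by (intro eventually_next_point_value) simp
  then show ?thesis
    by eventually_elim (use hit_set_value[OF h] in \<open>auto simp: unfinished_def next_point_def\<close>)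
qed

text \<open>Sampling at the grid point to the right of \<open>t\<close>, not to the left, is what
  right-continuity makes consistent.\<close>

lemma eventually_unfinished_iff:
  assumes t: "0 \<le> t" and k: "k \<noteq> e" "k \<noteq> c"
  shows "\<forall>\<^sub>F n in sequentially.
    (unfinished e c (grid_path n) (next_index (mesh n) t) \<and> x (next_point n t) = k) =
    (endings \<inter> {..t} = {} \<and> x t = k)"
proof (cases "x t = k")
  case False
  from eventually_next_point_value[OF t] show ?thesis by eventually_elim (use False in auto)
next
  case True
  show ?thesis
  proof (cases "endings \<inter> {..t} = {}")
    case no_end: True
    obtain q1 where q1: "t < q1" "hit_set x e \<inter> {..<q1} = {}"
      using no_hit_extends[OF t, of e] no_end by blast
    obtain q2 where q2: "t < q2" "hit_set x c \<inter> {..<q2} = {}"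
      using no_hit_extends[OF t, of c] no_end by blast
    have "\<forall>\<^sub>F n in sequentially. next_point n t < min q1 q2"
      using q1 q2 by (intro eventually_next_point_less t) simp
    with eventually_next_point_value[OF t] show ?thesis
    proof eventually_elim
      case (elim n)
      have "unfinished e c (grid_path n) (next_index (mesh n) t)"
      proof (rule ccontr)
        assume "\<not> ?thesis"
        then obtain l where l: "l \<le> next_index (mesh n) t" "real l * mesh n \<in> endings"
          by (rule finished_on_grid)
        then have "real l * mesh n \<le> next_point n t"
          using mesh_pos[of n] by (simp add: next_point_def)
        then have "real l * mesh n < q1" "real l * mesh n < q2" using elim by auto
        then show False using l(2) q1(2) q2(2) by blast
      qed
      then show ?case using elim True no_end by simp
    qed
  next
    case False
    then obtain h where h: "h \<in> endings" "h \<le> t" by auto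
    from eventually_finished[OF h(1)] show ?thesis
      by eventually_elim (use False unfinished_mono next_index_mono[OF h(2)] in blast)
  qed
qed

text \<open>The grid point just after \<open>h\<close> sees \<open>c\<close>, and on fine grids it comes before any return
  to \<open>e\<close>. The grid may see \<open>c\<close> even earlier, hence the least index.\<close>

lemma eventually_hit_target:
  assumes h: "h \<in> hit_set x c" and none: "hit_set x e \<inter> {..h} = {}"
  shows "\<forall>\<^sub>F n in sequentially. \<exists>m. unfinished e c (grid_path n) m \<and> grid_path n (Suc m) = c"
proof -
  have h0: "0 \<le> h" using hit_set_pos[OF h] by simp
  obtain r where r: "h < r" "hit_set x e \<inter> {..<r} = {}" using no_hit_extends[OF h0 none] by blast
  from eventually_next_point_value[OF h0] eventually_next_point_less[OF h0 r(1)] show ?thesis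
  proof eventually_elim
    case (elim n)
    let ?k = "LEAST k. grid_path n k = c"
    have ex: "grid_path n (next_index (mesh n) h) = c"
      using elim hit_set_value[OF h] by (simp add: next_point_def)
    have k: "grid_path n ?k = c" using ex by (rule LeastI)
    have le: "?k \<le> next_index (mesh n) h" using ex by (rule Least_le)
    have "?k \<noteq> 0" using k path_start neq by (intro notI) auto
    then obtain m where m: "?k = Suc m" using not0_implies_Suc by blast
    have "unfinished e c (grid_path n) m"
    proof (rule ccontr)
      assume "\<not> ?thesis"
      then obtain l where l: "l \<le> m" "real l * mesh n \<in> endings" by (rule finished_on_grid)
      have "grid_path n l \<noteq> c" using l(1) m not_less_Least[of l "\<lambda>k. grid_path n k = c"] by auto
      then have ret: "real l * mesh n \<in> hit_set x e" using l(2) hit_set_value by blast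
      have "real l * mesh n \<le> next_point n h"
        using l(1) m le mesh_pos[of n] by (simp add: next_point_def)
      then show False using ret r(2) elim(2) by auto
    qed
    then show ?case using k m by auto
  qed
qed

lemma eventually_not_hit_target:
  assumes h: "h \<in> hit_set x e" and none: "hit_set x c \<inter> {..h} = {}"
  shows "\<forall>\<^sub>F n in sequentially. \<not> (\<exists>m. unfinished e c (grid_path n) m \<and> grid_path n (Suc m) = c)"
proof -
  have h0: "0 \<le> h" using hit_set_pos[OF h] by simp
  obtain r where r: "h < r" "hit_set x c \<inter> {..<r} = {}" using no_hit_extends[OF h0 none] by blast
  from eventually_return_on_grid[OF h] eventually_next_point_less[OF h0 r(1)] show ?thesis
  proof eventually_elim
    case (elim n)
    show ?case
    proof
      assume "\<exists>m. unfinished e c (grid_path n) m \<and> grid_path n (Suc m) = c"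
      then obtain m where m: "unfinished e c (grid_path n) m" "grid_path n (Suc m) = c" by auto
      then have "real (Suc m) * mesh n \<in> hit_set x c"
        using path_start neq mesh_pos[of n] by (simp add: hit_set_def)
      then have "r \<le> real (Suc m) * mesh n" using r(2) by force
      with elim(2) have "next_index (mesh n) h < Suc m"
        using mesh_pos[of n] unfolding next_point_def by (metis less_le_trans mult_less_cancel_right_pos of_nat_less_iff)
      then have "unfinished e c (grid_path n) (next_index (mesh n) h)"
        using m(1) by (auto intro: unfinished_mono)
      then show False using elim(1) by (auto simp: unfinished_def next_point_def)
    qed
  qed
qed

lemma eventually_hit_target_iff:
  assumes "endings \<noteq> {}"
  shows "\<forall>\<^sub>F n in sequentially.
    (\<exists>m. unfinished e c (grid_path n) m \<and> grid_path n (Suc m) = c) =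
    (Inf (ereal ` hit_set x c) < Inf (ereal ` hit_set x e))"
proof (cases "Inf (ereal ` hit_set x c) < Inf (ereal ` hit_set x e)")
  case True
  then obtain h where h: "h \<in> hit_set x c" "ereal h < Inf (ereal ` hit_set x e)"
    unfolding Inf_less_iff by auto
  then have "hit_set x e \<inter> {..h} = {}"
    using less_hitting_iff[of h] hit_set_pos[OF h(1)] by simp
  from eventually_hit_target[OF h(1) this] show ?thesis by eventually_elim (use True in auto)
next
  case False
  moreover have "Inf (ereal ` hit_set x e) \<noteq> Inf (ereal ` hit_set x c)"
    by (rule hitting_times_neq[OF neq assms])
  ultimately have "Inf (ereal ` hit_set x e) < Inf (ereal ` hit_set x c)"
    using linorder_less_linear by blast
  then obtain h where h: "h \<in> hit_set x e" "ereal h < Inf (ereal ` hit_set x c)"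
    unfolding Inf_less_iff by auto
  then have "hit_set x c \<inter> {..h} = {}"
    using less_hitting_iff[of h] hit_set_pos[OF h(1)] by simp
  from eventually_not_hit_target[OF h(1) this] show ?thesis by eventually_elim (use False in auto)
qed

lemma unfinished_coarser:
  assumes "0 \<le> t" "unfinished e c (grid_path (n0 + n)) (next_index (mesh (n0 + n)) t)"
  shows "unfinished e c (grid_path n0) (nat \<lfloor>t / mesh n0\<rfloor>)"
proof -
  have "nat \<lfloor>t / mesh n0\<rfloor> * 2 ^ n \<le> next_index (mesh (n0 + n)) t"
    using coarse_index_le[OF assms(1), of n0 n] by (simp add: next_index_def)
  from unfinished_subsequence[OF assms(2) this]
  have "unfinished e c (\<lambda>l. grid_path (n0 + n) (l * 2 ^ n)) (nat \<lfloor>t / mesh n0\<rfloor>)" by simp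
  moreover have "grid_path (n0 + n) (l * 2 ^ n) = grid_path n0 l" for l
    using mesh_add[of n n0] by (simp add: mult.assoc)
  ultimately show ?thesis by simp
qed

end

section \<open>Excursion quantities as limits of grid quantities\<close>

lemma nn_integral_step_function:
  fixes F :: "nat \<Rightarrow> ennreal"
  assumes d: "0 < d"
  shows "(\<integral>\<^sup>+t. indicator {0..} t * F (nat \<lfloor>t / d\<rfloor>) \<partial>lborel) = ennreal d * (\<Sum>m. F m)"
proof -
  define A where "A m = {real m * d..<real (Suc m) * d}" for m
  have index: "t \<in> A m \<longleftrightarrow> 0 \<le> t \<and> nat \<lfloor>t / d\<rfloor> = m" for t m
  proof -
    have "t \<in> A m \<longleftrightarrow> real m \<le> t / d \<and> t / d < real m + 1"
      using d by (simp add: A_def field_simps)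
    also have "\<dots> \<longleftrightarrow> \<lfloor>t / d\<rfloor> = int m" by linarith
    also have "\<dots> \<longleftrightarrow> 0 \<le> t \<and> nat \<lfloor>t / d\<rfloor> = m"
      using d by (auto simp: zero_le_divide_iff) (metis floor_mono floor_zero of_nat_0_le_iff d
        zero_le_floor zero_le_divide_iff less_le_not_le)
    finally show ?thesis .
  qed
  have dis: "disjoint_family A" by (auto simp: disjoint_family_on_def index)
  have step: "indicator {0..} t * F (nat \<lfloor>t / d\<rfloor>) = (\<Sum>m. F m * indicator (A m) t)" for t
  proof (cases "0 \<le> t")
    case True
    then have "t \<in> A (nat \<lfloor>t / d\<rfloor>)" by (simp add: index)
    from suminf_cmult_indicator[OF dis this, of F] True show ?thesis by simp
  next
    case False
    then have "t \<notin> A m" for m by (simp add: index)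
    with False show ?thesis by simp
  qed
  have "(\<integral>\<^sup>+t. indicator {0..} t * F (nat \<lfloor>t / d\<rfloor>) \<partial>lborel) = (\<Sum>m. \<integral>\<^sup>+t. F m * indicator (A m) t \<partial>lborel)"
    unfolding step by (rule nn_integral_suminf) (auto simp: A_def)
  also have "\<dots> = (\<Sum>m. F m * ennreal d)"
  proof (intro suminf_cong)
    fix m
    have "emeasure lborel (A m) = ennreal d"
      unfolding A_def using d by (subst emeasure_lborel_Ico) (auto simp: algebra_simps)
    then show "(\<integral>\<^sup>+t. F m * indicator (A m) t \<partial>lborel) = F m * ennreal d"
      by (subst nn_integral_cmult_indicator) (auto simp: A_def)
  qed
  finally show ?thesis by (simp add: mult.commute)
qed

lemma measurable_step_function:
  fixes F :: "nat \<Rightarrow> ennreal" and d :: real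
  shows "(\<lambda>t. indicator {0..} t * F (nat \<lfloor>t / d\<rfloor>)) \<in> borel_measurable lborel"
proof -
  have "(\<lambda>t::real. nat \<lfloor>t / d\<rfloor>) \<in> measurable lborel (count_space UNIV)" by measurable
  then have "(\<lambda>t. F (nat \<lfloor>t / d\<rfloor>)) \<in> borel_measurable lborel"
    by (rule measurable_compose) simp
  then show ?thesis by (intro borel_measurable_times_ennreal borel_measurable_indicator) auto
qed

lemma ennreal_suminf_infinite:
  fixes f :: "nat \<Rightarrow> ennreal"
  assumes "\<And>m. 1 \<le> f m"
  shows "(\<Sum>m. f m) = \<infinity>"
proof (rule ccontr)
  assume "(\<Sum>m. f m) \<noteq> \<infinity>"
  then obtain N where N: "(\<Sum>m. f m) < of_nat N"
    using ennreal_Ex_less_of_nat[of "\<Sum>m. f m"] by (auto simp: less_top)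
  have "of_nat N = (\<Sum>m<N. (1::ennreal))" by simp
  also have "\<dots> \<le> (\<Sum>m<N. f m)" by (intro sum_mono assms)
  also have "\<dots> \<le> (\<Sum>m. f m)" by (rule sum_le_suminf) auto
  finally show False using N by simp
qed

text \<open>Right-continuity allows the times in the definition to be taken rational.\<close>

lemma (in ctmc) hitting_time_measurable:
  assumes i: "i \<in> V"
  shows "hitting_time X a \<in> borel_measurable (M i)"
proof (rule borel_measurableI_less)
  fix y :: ereal
  have rational: "\<exists>q\<in>\<rat>. t \<le> q \<and> q < b \<and> X q \<omega> = X t \<omega>" if w: "\<omega> \<in> space (M i)" and t: "0 \<le> t" "t < b" for \<omega> t b
  proof -
    interpret right_continuous_path "\<lambda>t. X t \<omega>"
      by unfold_locales (rule right_continuous[OF i w])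
    obtain r where r: "0 < r" "\<And>u. t \<le> u \<Longrightarrow> u < t + r \<Longrightarrow> X u \<omega> = X t \<omega>"
      using constant_right[OF t(1)] by blast
    have "t < min b (t + r)" using r t by simp
    then obtain q where "q \<in> \<rat>" "t < q" "q < min b (t + r)" using Rats_dense_in_real by blast
    then show ?thesis using r(2)[of q] by (intro bexI[of _ q]) auto
  qed
  let ?S = "\<lambda>t B. {\<omega> \<in> space (M i). X t \<omega> \<in> B}"
  have "{\<omega> \<in> space (M i). hitting_time X a \<omega> < y} =
    (?S 0 {a} \<inter> (\<Union>t\<in>{t\<in>\<rat>. 0 < t \<and> ereal t < y}. \<Union>u\<in>{u\<in>\<rat>. 0 < u \<and> u < t}. ?S u (- {a}) \<inter> ?S t {a})) \<union>
    (?S 0 (- {a}) \<inter> (\<Union>t\<in>{t\<in>\<rat>. 0 < t \<and> ereal t < y}. ?S t {a}))" (is "?L = ?R")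
  proof (intro equalityI subsetI)
    fix \<omega> assume w: "\<omega> \<in> ?R"
    then consider t u where "X 0 \<omega> = a" "0 < u" "u < t" "ereal t < y" "X u \<omega> \<noteq> a" "X t \<omega> = a"
      | t where "X 0 \<omega> \<noteq> a" "0 < t" "ereal t < y" "X t \<omega> = a"
      by auto
    then obtain t where "t \<in> hit_set (\<lambda>t. X t \<omega>) a" "ereal t < y"
    proof cases
      case (1 t u)
      then have "t \<in> hit_set (\<lambda>t. X t \<omega>) a" by (auto simp: hit_set_def)
      then show ?thesis using that 1 by blast
    next
      case (2 t)
      then have "t \<in> hit_set (\<lambda>t. X t \<omega>) a" by (auto simp: hit_set_def)
      then show ?thesis using that 2 by blast
    qed
    then have "hitting_time X a \<omega> < y" unfolding hitting_time_eq Inf_less_iff by blast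
    then show "\<omega> \<in> ?L" using w by auto
  next
    fix \<omega> assume "\<omega> \<in> ?L"
    then have w: "\<omega> \<in> space (M i)" and less: "Inf (ereal ` hit_set (\<lambda>t. X t \<omega>) a) < y"
      unfolding hitting_time_eq by auto
    then obtain t where t: "t \<in> hit_set (\<lambda>t. X t \<omega>) a" "ereal t < y" by (auto simp: Inf_less_iff)
    have t0: "0 < t" "X t \<omega> = a" using hit_set_pos[OF t(1)] hit_set_value[OF t(1)] by auto
    obtain b where b: "t < b" "ereal b \<le> y"
      using t(2) ereal_dense2[OF t(2)] by (metis ereal_less(1) less_ereal.simps(1) less_imp_le)
    obtain q where q: "q \<in> \<rat>" "t \<le> q" "q < b" "X q \<omega> = X t \<omega>"
      using rational[OF w, of t b] t0 b by auto
    then have qy: "ereal q < y" using b by (auto intro: less_le_trans[of _ "ereal b"])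
    show "\<omega> \<in> ?R"
    proof (cases "X 0 \<omega> = a")
      case False
      then show ?thesis using q qy t0 w by auto
    next
      case True
      then obtain u where u: "0 < u" "u < t" "X u \<omega> \<noteq> a" using t(1) by (auto simp: hit_set_def)
      obtain p where p: "p \<in> \<rat>" "u \<le> p" "p < t" "X p \<omega> = X u \<omega>"
        using rational[OF w, of u t] u by auto
      have "\<omega> \<in> ?S p (- {a}) \<inter> ?S q {a}" using p q u t0 w by auto
      moreover have "q \<in> {t\<in>\<rat>. 0 < t \<and> ereal t < y}" "p \<in> {u\<in>\<rat>. 0 < u \<and> u < q}"
        using p q qy t0 u by auto
      ultimately show ?thesis using True w by blast
    qed
  qed
  also have "\<dots> \<in> sets (M i)"
    by (intro sets.Un sets.Int sets.countable_UN'' state_event i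
        countable_subset[OF _ countable_rat]) auto
  finally show "{\<omega> \<in> space (M i). hitting_time X a \<omega> < y} \<in> sets (M i)" .
qed

context excursion
begin

definition visit_event :: "nat \<Rightarrow> nat \<Rightarrow> int \<Rightarrow> 'a set" where
  "visit_event n m i = {\<omega> \<in> space (M e). unfinished e c (grid (mesh n) \<omega>) m \<and> grid (mesh n) \<omega> m = i}"

definition target_event :: "nat \<Rightarrow> 'a set" where
  "target_event n = {\<omega> \<in> space (M e).
     \<exists>m. unfinished e c (grid (mesh n) \<omega>) m \<and> grid (mesh n) \<omega> (Suc m) = c}"

text \<open>The sum starts with the visit at index \<open>1\<close>, because each mesh interval is sampled at its
  right end.\<close>

definition grid_occupation :: "nat \<Rightarrow> int \<Rightarrow> 'a \<Rightarrow> ennreal" where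
  "grid_occupation n k \<omega> = ennreal (mesh n) * (\<Sum>m. indicator (visit_event n (Suc m) k) \<omega>)"

definition grid_duration :: "nat \<Rightarrow> 'a \<Rightarrow> ennreal" where
  "grid_duration n \<omega> = ennreal (mesh n) * (\<Sum>m. \<Sum>i\<in>V - {c}. indicator (visit_event n m i) \<omega>)"

abbreviation ending_times :: "'a \<Rightarrow> real set" where
  "ending_times \<omega> \<equiv> hit_set (\<lambda>t. X t \<omega>) e \<union> hit_set (\<lambda>t. X t \<omega>) c"

definition excursion_occ :: "int \<Rightarrow> 'a \<Rightarrow> ennreal" where
  "excursion_occ k \<omega> =
     (\<integral>\<^sup>+t. indicator {0..} t * of_bool (ending_times \<omega> \<inter> {..t} = {} \<and> X t \<omega> = k) \<partial>lborel)"

lemma visit_event_measurable [measurable]: "visit_event n m i \<in> sets (M e)"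
  unfolding visit_event_def using grid_event[OF mesh_pos, of n m m UNIV m "{i}"] by simp

lemma target_event_measurable [measurable]: "target_event n \<in> sets (M e)"
proof -
  have "target_event n = (\<Union>m. {\<omega> \<in> space (M e). unfinished e c (grid (mesh n) \<omega>) m \<and> grid (mesh n) \<omega> (Suc m) = c})"
    by (auto simp: target_event_def)
  also have "\<dots> \<in> sets (M e)"
    using grid_event[OF mesh_pos, of n _ _ UNIV "Suc _" "{c}"] by (intro sets.countable_UN) auto
  finally show ?thesis .
qed

lemma grid_occupation_measurable [measurable]: "grid_occupation n k \<in> borel_measurable (M e)"
  unfolding grid_occupation_def by measurable

lemma grid_duration_measurable [measurable]: "grid_duration n \<in> borel_measurable (M e)"
  unfolding grid_duration_def by measurable

lemma emeasure_visit_event: "emeasure (M e) (visit_event n m i) = ennreal (grid_visit (mesh n) m i)"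
proof -
  interpret prob_space "M e" by (rule prob_space_start)
  show ?thesis by (simp add: emeasure_eq_measure visit_event_def grid_visit_def)
qed

lemma nn_integral_grid_occupation:
  assumes k: "k \<in> V - {e, c}" and sum: "summable (\<lambda>m. grid_visit (mesh n) m k)"
  shows "(\<integral>\<^sup>+\<omega>. grid_occupation n k \<omega> \<partial>M e) = ennreal (mesh n * grid_visits (mesh n) k)"
proof -
  have "(\<integral>\<^sup>+\<omega>. grid_occupation n k \<omega> \<partial>M e) = ennreal (mesh n) * (\<Sum>m. ennreal (grid_visit (mesh n) (Suc m) k))"
    unfolding grid_occupation_def
    by (subst nn_integral_cmult) (simp_all add: nn_integral_suminf emeasure_visit_event)
  also have "(\<Sum>m. ennreal (grid_visit (mesh n) (Suc m) k)) = ennreal (\<Sum>m. grid_visit (mesh n) (Suc m) k)"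
    using sum by (intro suminf_ennreal2 grid_visit_nonneg) (subst summable_Suc_iff)
  also have "(\<Sum>m. grid_visit (mesh n) (Suc m) k) = grid_visits (mesh n) k"
    using suminf_split_head[OF sum] k by (simp add: grid_visits_def grid_visit_0[OF mesh_pos])
  finally show ?thesis
    using suminf_nonneg[OF sum grid_visit_nonneg] by (simp add: ennreal_mult'' grid_visits_def)
qed

lemma nn_integral_grid_duration:
  assumes "\<forall>i\<in>V - {c}. summable (\<lambda>m. grid_visit (mesh n) m i)"
  shows "(\<integral>\<^sup>+\<omega>. grid_duration n \<omega> \<partial>M e) < \<infinity>"
proof -
  have "(\<integral>\<^sup>+\<omega>. grid_duration n \<omega> \<partial>M e)
      = ennreal (mesh n) * (\<Sum>m. \<Sum>i\<in>V - {c}. ennreal (grid_visit (mesh n) m i))"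
    unfolding grid_duration_def
    by (subst nn_integral_cmult)
      (simp_all add: nn_integral_suminf nn_integral_sum emeasure_visit_event)
  also have "(\<Sum>m. \<Sum>i\<in>V - {c}. ennreal (grid_visit (mesh n) m i))
      = (\<Sum>m. ennreal (\<Sum>i\<in>V - {c}. grid_visit (mesh n) m i))"
    by (simp add: sum_ennreal grid_visit_nonneg)
  also have "\<dots> = ennreal (\<Sum>m. \<Sum>i\<in>V - {c}. grid_visit (mesh n) m i)"
    using assms by (intro suminf_ennreal2 sum_nonneg grid_visit_nonneg summable_sum) auto
  finally show ?thesis by (simp add: ennreal_mult_less_top)
qed

text \<open>The paths for which all pathwise limits below hold. Finite duration on the coarse grid
  ensures that the excursion ends and supplies the bound for dominated convergence.\<close>

definition regular_path :: "nat \<Rightarrow> 'a \<Rightarrow> bool" where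
  "regular_path n \<omega> \<longleftrightarrow> \<omega> \<in> space (M e) \<and> X 0 \<omega> = e \<and> grid_duration n \<omega> < \<infinity>"

lemma AE_regular_path:
  assumes "\<forall>i\<in>V - {c}. summable (\<lambda>m. grid_visit (mesh n) m i)"
  shows "AE \<omega> in M e. regular_path n \<omega>"
proof -
  have "AE \<omega> in M e. grid_duration n \<omega> \<noteq> \<infinity>"
    by (rule nn_integral_PInf_AE) (use nn_integral_grid_duration[OF assms] in auto)
  then show ?thesis
    using start[OF start_state] AE_space
    by eventually_elim (simp add: regular_path_def less_top)
qed

lemma excursion_path_regular:
  assumes "regular_path n \<omega>"
  shows "excursion_path (\<lambda>t. X t \<omega>) e c"
  using assms right_continuous[OF start_state] start_target_neq
  by unfold_locales (auto simp: regular_path_def)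

lemma visit_sum_ge:
  assumes w: "\<omega> \<in> space (M e)" and u: "unfinished e c (grid (mesh n) \<omega>) m"
  shows "1 \<le> (\<Sum>i\<in>V - {c}. indicator (visit_event n m i) \<omega> :: ennreal)"
proof -
  let ?i = "grid (mesh n) \<omega> m"
  have i: "?i \<in> V - {c}"
    using grid_in_states[OF start_state w] unfinished_not_target[OF u] mesh_pos[of n] by simp
  have "(1::ennreal) = indicator (visit_event n m ?i) \<omega>" using w u by (simp add: visit_event_def)
  also have "\<dots> \<le> (\<Sum>i\<in>V - {c}. indicator (visit_event n m i) \<omega>)"
    by (rule member_le_sum[OF i]) (use finite_states in auto)
  finally show ?thesis .
qed

lemma grid_eq: "grid (mesh n) \<omega> = (\<lambda>l. X (real l * mesh n) \<omega>)"
  by (simp add: grid_def fun_eq_iff)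

text \<open>An excursion that never ends would have infinite duration on the coarse grid.\<close>

lemma endings_nonempty:
  assumes r: "regular_path n \<omega>"
  shows "ending_times \<omega> \<noteq> {}"
proof
  assume none: "ending_times \<omega> = {}"
  interpret excursion_path "\<lambda>t. X t \<omega>" e c by (rule excursion_path_regular[OF r])
  have "unfinished e c (grid (mesh n) \<omega>) m" for m
  proof (rule ccontr)
    assume "\<not> ?thesis"
    then have "\<not> unfinished e c (\<lambda>l. X (real l * mesh n) \<omega>) m" by (simp add: grid_eq)
    then obtain l where "real l * mesh n \<in> ending_times \<omega>" by (rule finished_on_grid)
    then show False using none by simp
  qed
  then have "(\<Sum>m. \<Sum>i\<in>V - {c}. indicator (visit_event n m i) \<omega> :: ennreal) = \<infinity>"
    using r by (intro ennreal_suminf_infinite visit_sum_ge) (auto simp: regular_path_def)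
  then have "grid_duration n \<omega> = \<infinity>"
    using mesh_pos[of n] by (simp add: grid_duration_def ennreal_mult_eq_top_iff)
  then show False using r by (simp add: regular_path_def)
qed

lemma grid_occupation_integral:
  assumes w: "\<omega> \<in> space (M e)"
  shows "grid_occupation n k \<omega> = (\<integral>\<^sup>+t. indicator {0..} t *
    of_bool (unfinished e c (grid (mesh n) \<omega>) (next_index (mesh n) t) \<and> X (next_point n t) \<omega> = k) \<partial>lborel)"
proof -
  have "grid_occupation n k \<omega> = (\<integral>\<^sup>+t. indicator {0..} t *
      indicator (visit_event n (Suc (nat \<lfloor>t / mesh n\<rfloor>)) k) \<omega> \<partial>lborel)"
    unfolding grid_occupation_def
    by (rule nn_integral_step_function[OF mesh_pos, symmetric])
  also have "\<dots> = (\<integral>\<^sup>+t. indicator {0..} t *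
    of_bool (unfinished e c (grid (mesh n) \<omega>) (next_index (mesh n) t) \<and> X (next_point n t) \<omega> = k) \<partial>lborel)"
    using w by (intro nn_integral_cong arg_cong2[where f = "(*)"] refl)
      (auto simp: visit_event_def next_index_def next_point_def grid_def indicator_def)
  finally show ?thesis .
qed

lemma step_integrand_measurable:
  "(\<lambda>t. indicator {0..} t *
    of_bool (unfinished e c (grid (mesh n) \<omega>) (next_index (mesh n) t) \<and> X (next_point n t) \<omega> = k) :: ennreal)
   \<in> borel_measurable lborel"
  unfolding next_index_def next_point_def
  by (rule measurable_step_function[where F = "\<lambda>m. of_bool (unfinished e c (grid (mesh n) \<omega>) (Suc m) \<and>
      X (real (Suc m) * mesh n) \<omega> = k)"])

text \<open>Refining the grid only makes excursions end earlier, so a single coarse grid provides the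
  integrable bound for all finer ones.\<close>

lemma duration_bound:
  assumes w: "regular_path n0 \<omega>"
  shows "indicator {0..} t * of_bool (unfinished e c (grid (mesh (n0 + n)) \<omega>) (next_index (mesh (n0 + n)) t) \<and>
      X (next_point (n0 + n) t) \<omega> = k)
    \<le> indicator {0..} t * (\<Sum>i\<in>V - {c}. indicator (visit_event n0 (nat \<lfloor>t / mesh n0\<rfloor>) i) \<omega> :: ennreal)"
proof (cases "0 \<le> t \<and> unfinished e c (grid (mesh (n0 + n)) \<omega>) (next_index (mesh (n0 + n)) t)")
  case True
  interpret excursion_path "\<lambda>t. X t \<omega>" e c by (rule excursion_path_regular[OF w])
  have "unfinished e c (grid (mesh n0) \<omega>) (nat \<lfloor>t / mesh n0\<rfloor>)"
    using unfinished_coarser[of t n0 n] True by (simp add: grid_eq)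
  from visit_sum_ge[OF _ this] w True show ?thesis
    by (auto simp: regular_path_def of_bool_def)
qed auto

lemma grid_occupation_le_duration:
  assumes w: "regular_path n0 \<omega>"
  shows "grid_occupation (n0 + n) k \<omega> \<le> grid_duration n0 \<omega>"
proof -
  have "grid_occupation (n0 + n) k \<omega> \<le> (\<integral>\<^sup>+t. indicator {0..} t *
      (\<Sum>i\<in>V - {c}. indicator (visit_event n0 (nat \<lfloor>t / mesh n0\<rfloor>) i) \<omega>) \<partial>lborel)"
    using w by (subst grid_occupation_integral)
      (auto simp: regular_path_def intro!: nn_integral_mono duration_bound[OF w])
  also have "\<dots> = grid_duration n0 \<omega>"
    unfolding grid_duration_def by (rule nn_integral_step_function[OF mesh_pos])
  finally show ?thesis .
qed

lemma grid_occupation_tendsto: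
  assumes w: "regular_path n0 \<omega>" and k: "k \<in> V - {e, c}"
  shows "(\<lambda>n. grid_occupation (n0 + n) k \<omega>) \<longlonglongrightarrow> excursion_occ k \<omega>"
proof -
  interpret excursion_path "\<lambda>t. X t \<omega>" e c by (rule excursion_path_regular[OF w])
  define f :: "nat \<Rightarrow> real \<Rightarrow> ennreal" where "f n t = indicator {0..} t *
    of_bool (unfinished e c (grid (mesh (n0 + n)) \<omega>) (next_index (mesh (n0 + n)) t) \<and> X (next_point (n0 + n) t) \<omega> = k)" for n t
  define g :: "real \<Rightarrow> ennreal" where "g t = indicator {0..} t * of_bool (ending_times \<omega> \<inter> {..t} = {} \<and> X t \<omega> = k)" for t
  have lim: "(\<lambda>n. f n t) \<longlonglongrightarrow> g t" for t
  proof (cases "0 \<le> t")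
    case True
    have "k \<noteq> e" "k \<noteq> c" using k by auto
    from sequentially_offset[OF eventually_unfinished_iff[OF True this], of n0]
    have "\<forall>\<^sub>F n in sequentially. f n t = g t"
      by eventually_elim (simp only: f_def g_def grid_eq add.commute[of n0])
    then show ?thesis by (rule tendsto_eventually)
  qed (simp add: f_def g_def)
  have meas: "f n \<in> borel_measurable lborel" for n
    unfolding f_def by (rule step_integrand_measurable)
  have "(\<lambda>n. \<integral>\<^sup>+t. f n t \<partial>lborel) \<longlonglongrightarrow> (\<integral>\<^sup>+t. g t \<partial>lborel)"
  proof (rule nn_integral_dominated_convergence[OF meas])
    show "g \<in> borel_measurable lborel"
      by (rule borel_measurable_LIMSEQ_order[OF lim meas])
    show "(\<lambda>t. indicator {0..} t * (\<Sum>i\<in>V - {c}. indicator (visit_event n0 (nat \<lfloor>t / mesh n0\<rfloor>) i) \<omega>) :: ennreal)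
        \<in> borel_measurable lborel"
      by (rule measurable_step_function[where F = "\<lambda>m. \<Sum>i\<in>V - {c}. indicator (visit_event n0 m i) \<omega>"])
    show "AE t in lborel. f n t
        \<le> indicator {0..} t * (\<Sum>i\<in>V - {c}. indicator (visit_event n0 (nat \<lfloor>t / mesh n0\<rfloor>) i) \<omega>)" for n
      unfolding f_def by (intro AE_I2 duration_bound[OF w])
    have "(\<integral>\<^sup>+t. indicator {0..} t * (\<Sum>i\<in>V - {c}. indicator (visit_event n0 (nat \<lfloor>t / mesh n0\<rfloor>) i) \<omega>) \<partial>lborel)
        = grid_duration n0 \<omega>"
      unfolding grid_duration_def by (rule nn_integral_step_function[OF mesh_pos])
    then show "(\<integral>\<^sup>+t. indicator {0..} t * (\<Sum>i\<in>V - {c}. indicator (visit_event n0 (nat \<lfloor>t / mesh n0\<rfloor>) i) \<omega>) \<partial>lborel) < \<infinity>"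
      using w by (simp add: regular_path_def)
    show "AE t in lborel. (\<lambda>n. f n t) \<longlonglongrightarrow> g t" using lim by simp
  qed
  then show ?thesis
    using w unfolding excursion_occ_def g_def f_def
    by (simp add: grid_occupation_integral regular_path_def)
qed

end

section \<open>Balance equations for excursions\<close>

context excursion
begin

lemma less_both_hitting_iff:
  assumes "regular_path n \<omega>" "0 \<le> t"
  shows "ereal t < hitting_time X e \<omega> \<and> ereal t < hitting_time X c \<omega> \<longleftrightarrow> ending_times \<omega> \<inter> {..t} = {}"
proof -
  interpret excursion_path "\<lambda>t. X t \<omega>" e c by (rule excursion_path_regular[OF assms(1)])
  show ?thesis unfolding hitting_time_eq less_hitting_iff[OF assms(2)] by auto
qed

lemma hitting_time_less_cases:
  assumes "regular_path n \<omega>"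
  shows "hitting_time X e \<omega> < hitting_time X c \<omega> \<or> hitting_time X c \<omega> < hitting_time X e \<omega>"
proof -
  interpret excursion_path "\<lambda>t. X t \<omega>" e c by (rule excursion_path_regular[OF assms])
  have "hitting_time X e \<omega> \<noteq> hitting_time X c \<omega>"
    unfolding hitting_time_eq
    by (rule hitting_times_neq[OF start_target_neq endings_nonempty[OF assms]])
  then show ?thesis using linorder_less_linear by blast
qed

lemma occupation_time_eq:
  assumes w: "regular_path n \<omega>"
    and a: "(a = e \<and> b = c) \<or> (a = c \<and> b = e)" and less: "hitting_time X a \<omega> < hitting_time X b \<omega>"
  shows "occupation_time X a k \<omega> = excursion_occ k \<omega>"
  unfolding occupation_time_def excursion_occ_def
proof (rule nn_integral_cong)
  fix t :: real
  have "ereal t < hitting_time X a \<omega> \<longleftrightarrow> ereal t < hitting_time X e \<omega> \<and> ereal t < hitting_time X c \<omega>"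
    using a less by auto
  then have "0 \<le> t \<Longrightarrow> ereal t < hitting_time X a \<omega> \<longleftrightarrow> ending_times \<omega> \<inter> {..t} = {}"
    using less_both_hitting_iff[OF w] by simp
  then show "indicator {k} (X t \<omega>) * indicator {t. 0 \<le> t \<and> ereal t < hitting_time X a \<omega>} t
      = (indicator {0..} t * of_bool (ending_times \<omega> \<inter> {..t} = {} \<and> X t \<omega> = k) :: ennreal)"
    by (auto simp: indicator_def)
qed

text \<open>Splitting by the state in which the excursion ends recovers the unconditional expected
  occupation time: conditional expectations are weighted by the probabilities they were
  divided by, and some end is reached almost surely. The function \<open>L\<close> is a measurable version of
  the occupation time, which is obtained as a limit only almost everywhere.\<close>

lemma split_by_end:
  assumes L: "L \<in> borel_measurable (M e)"
    and eq: "AE \<omega> in M e. regular_path n \<omega> \<and> L \<omega> = excursion_occ k \<omega>"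
    and fin: "(\<integral>\<^sup>+\<omega>. L \<omega> \<partial>M e) < \<infinity>"
    and c: "c = 3 - e"
  shows "excursion_occupation Q M X e k = - Q e e * enn2real (\<integral>\<^sup>+\<omega>. L \<omega> \<partial>M e)"
proof -
  interpret prob_space "M e" by (rule prob_space_start)
  define F where "F a b = {\<omega> \<in> space (M e). hitting_time X a \<omega> < hitting_time X b \<omega>}" for a b
  define J where "J a b = (\<integral>\<^sup>+\<omega>\<in>{\<omega>. hitting_time X a \<omega> < hitting_time X b \<omega>}. occupation_time X a k \<omega> \<partial>M e)" for a b
  have F: "F a b \<in> sets (M e)" for a b
  proof -
    note [measurable] = hitting_time_measurable[OF start_state]
    show ?thesis unfolding F_def by measurable
  qed
  have J: "J a b = (\<integral>\<^sup>+\<omega>. L \<omega> * indicator (F a b) \<omega> \<partial>M e)"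
    if a: "(a = e \<and> b = c) \<or> (a = c \<and> b = e)" for a b
    unfolding J_def
  proof (rule nn_integral_cong_AE)
    show "AE \<omega> in M e. occupation_time X a k \<omega> * indicator {\<omega>. hitting_time X a \<omega> < hitting_time X b \<omega>} \<omega>
        = L \<omega> * indicator (F a b) \<omega>"
      using eq AE_space
    proof eventually_elim
      case (elim \<omega>)
      then show ?case using occupation_time_eq[OF _ a, of n \<omega> k] by (auto simp: F_def indicator_def)
    qed
  qed
  have weight: "excursion_intensity Q M X e a * cond_occupation M X e a k = - Q e e * enn2real (J a b)"
    if a: "(a = e \<and> b = c) \<or> (a = c \<and> b = e)" for a b
  proof -
    have b: "3 - a = b" using a c by auto
    have p: "excursion_prob M X e a = prob (F a b)"
      unfolding excursion_prob_def b F_def ..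
    show ?thesis
    proof (cases "prob (F a b) = 0")
      case True
      then have "F a b \<in> null_sets (M e)" using F by (simp add: null_sets_def emeasure_eq_measure)
      then have "J a b = 0" unfolding J[OF a] by (rule nn_integral_null_set)
      then show ?thesis using True by (simp add: excursion_intensity_def p)
    next
      case False
      then show ?thesis
        by (simp add: excursion_intensity_def cond_occupation_def p b J_def)
    qed
  qed
  have "(\<integral>\<^sup>+\<omega>. L \<omega> \<partial>M e) = (\<integral>\<^sup>+\<omega>. L \<omega> * indicator (F e c) \<omega> + L \<omega> * indicator (F c e) \<omega> \<partial>M e)"
  proof (rule nn_integral_cong_AE)
    show "AE \<omega> in M e. L \<omega> = L \<omega> * indicator (F e c) \<omega> + L \<omega> * indicator (F c e) \<omega>"
      using eq AE_space
    proof eventually_elim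
      case (elim \<omega>)
      then show ?case using hitting_time_less_cases[of n \<omega>] by (auto simp: F_def indicator_def)
    qed
  qed
  also have "\<dots> = J e c + J c e"
    using L F by (subst nn_integral_add) (auto simp: J)
  finally have total: "(\<integral>\<^sup>+\<omega>. L \<omega> \<partial>M e) = J e c + J c e" .
  then have "J e c < top" "J c e < top" using fin by (auto simp: ennreal_add_less_top)
  then have "enn2real (\<integral>\<^sup>+\<omega>. L \<omega> \<partial>M e) = enn2real (J e c) + enn2real (J c e)"
    unfolding total by (rule enn2real_plus)
  then show ?thesis
    unfolding excursion_occupation_def c[symmetric]
    using weight[of e c] weight[of c e] by (simp add: algebra_simps)
qed

lemma occupation_limit:
  assumes sum: "\<And>n. n0 \<le> n \<Longrightarrow> \<forall>i\<in>V - {c}. summable (\<lambda>m. grid_visit (mesh n) m i)"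
    and k: "k \<in> V - {e, c}" and c: "c = 3 - e"
  shows "(\<lambda>n. - Q e e * (mesh (n0 + n) * grid_visits (mesh (n0 + n)) k))
    \<longlonglongrightarrow> excursion_occupation Q M X e k"
proof -
  define L where "L \<omega> = liminf (\<lambda>n. grid_occupation (n0 + n) k \<omega>)" for \<omega>
  have L [measurable]: "L \<in> borel_measurable (M e)" unfolding L_def by measurable
  have reg: "AE \<omega> in M e. regular_path n0 \<omega>" by (rule AE_regular_path) (rule sum, simp)
  have eq: "AE \<omega> in M e. regular_path n0 \<omega> \<and> L \<omega> = excursion_occ k \<omega>"
    using reg
  proof eventually_elim
    case (elim \<omega>)
    then show ?case
      using lim_imp_Liminf[OF _ grid_occupation_tendsto[OF elim k]] by (simp add: L_def)
  qed
  have lim: "(\<lambda>n. \<integral>\<^sup>+\<omega>. grid_occupation (n0 + n) k \<omega> \<partial>M e) \<longlonglongrightarrow> (\<integral>\<^sup>+\<omega>. L \<omega> \<partial>M e)"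
  proof (rule nn_integral_dominated_convergence[where w = "grid_duration n0"])
    show "AE \<omega> in M e. grid_occupation (n0 + n) k \<omega> \<le> grid_duration n0 \<omega>" for n
      using reg by eventually_elim (rule grid_occupation_le_duration)
    show "(\<integral>\<^sup>+\<omega>. grid_duration n0 \<omega> \<partial>M e) < \<infinity>"
      by (rule nn_integral_grid_duration) (rule sum, simp)
    show "AE \<omega> in M e. (\<lambda>n. grid_occupation (n0 + n) k \<omega>) \<longlonglongrightarrow> L \<omega>"
      using eq by eventually_elim (auto intro: grid_occupation_tendsto[OF _ k])
  qed simp_all
  have "(\<integral>\<^sup>+\<omega>. L \<omega> \<partial>M e) \<le> (\<integral>\<^sup>+\<omega>. grid_duration n0 \<omega> \<partial>M e)"
  proof (rule nn_integral_mono_AE)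
    show "AE \<omega> in M e. L \<omega> \<le> grid_duration n0 \<omega>"
      using eq
    proof eventually_elim
      case (elim \<omega>)
      then show ?case
        using LIMSEQ_le_const2[OF grid_occupation_tendsto[OF _ k, of n0 \<omega>], of "grid_duration n0 \<omega>"]
          grid_occupation_le_duration[of n0 \<omega>] by auto
    qed
  qed
  also have "\<dots> < \<infinity>" by (rule nn_integral_grid_duration) (rule sum, simp)
  finally have fin: "(\<integral>\<^sup>+\<omega>. L \<omega> \<partial>M e) < \<infinity>" .
  have int: "(\<integral>\<^sup>+\<omega>. grid_occupation (n0 + n) k \<omega> \<partial>M e) = ennreal (mesh (n0 + n) * grid_visits (mesh (n0 + n)) k)" for n
    using k sum[of "n0 + n"] by (intro nn_integral_grid_occupation) auto
  have nonneg: "0 \<le> mesh (n0 + n) * grid_visits (mesh (n0 + n)) k" for n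
    unfolding grid_visits_def using k sum[of "n0 + n"] mesh_pos[of "n0 + n"]
    by (intro mult_nonneg_nonneg suminf_nonneg grid_visit_nonneg) auto
  have "(\<lambda>n. enn2real (ennreal (mesh (n0 + n) * grid_visits (mesh (n0 + n)) k)))
      \<longlonglongrightarrow> enn2real (\<integral>\<^sup>+\<omega>. L \<omega> \<partial>M e)"
    using lim fin unfolding int by (intro tendsto_enn2real) (simp_all add: less_top)
  then have "(\<lambda>n. mesh (n0 + n) * grid_visits (mesh (n0 + n)) k) \<longlonglongrightarrow> enn2real (\<integral>\<^sup>+\<omega>. L \<omega> \<partial>M e)"
    using nonneg by simp
  then have "(\<lambda>n. - Q e e * (mesh (n0 + n) * grid_visits (mesh (n0 + n)) k))
      \<longlonglongrightarrow> - Q e e * enn2real (\<integral>\<^sup>+\<omega>. L \<omega> \<partial>M e)"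
    by (rule tendsto_mult_left)
  then show ?thesis unfolding split_by_end[OF L eq fin c] .
qed

lemma target_limit:
  assumes sum: "\<And>n. n0 \<le> n \<Longrightarrow> \<forall>i\<in>V - {c}. summable (\<lambda>m. grid_visit (mesh n) m i)"
    and c: "c = 3 - e"
  shows "(\<lambda>n. measure (M e) (target_event (n0 + n))) \<longlonglongrightarrow> excursion_prob M X e c"
proof -
  interpret prob_space "M e" by (rule prob_space_start)
  define F where "F = {\<omega> \<in> space (M e). hitting_time X c \<omega> < hitting_time X e \<omega>}"
  note [measurable] = hitting_time_measurable[OF start_state]
  have F [measurable]: "F \<in> sets (M e)" unfolding F_def by measurable
  have p: "excursion_prob M X e c = prob F" using c by (simp add: excursion_prob_def F_def)
  have reg: "AE \<omega> in M e. regular_path n0 \<omega>" by (rule AE_regular_path) (rule sum, simp)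
  have "(\<lambda>n. \<integral>\<^sup>+\<omega>. indicator (target_event (n0 + n)) \<omega> \<partial>M e) \<longlonglongrightarrow> (\<integral>\<^sup>+\<omega>. indicator F \<omega> \<partial>M e)"
  proof (rule nn_integral_dominated_convergence[where w = "\<lambda>_. 1"])
    show "AE \<omega> in M e. (\<lambda>n. indicator (target_event (n0 + n)) \<omega> :: ennreal) \<longlonglongrightarrow> indicator F \<omega>"
      using reg
    proof eventually_elim
      case (elim \<omega>)
      interpret excursion_path "\<lambda>t. X t \<omega>" e c by (rule excursion_path_regular[OF elim])
      have "\<omega> \<in> space (M e)" using elim by (simp add: regular_path_def)
      then have "\<forall>\<^sub>F n in sequentially. indicator (target_event (n0 + n)) \<omega> = (indicator F \<omega> :: ennreal)"
        using eventually_hit_target_iff[OF endings_nonempty[OF elim], THEN sequentially_offset, of n0]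
        by (auto simp: target_event_def F_def grid_eq hitting_time_eq indicator_def add.commute
            elim!: eventually_mono)
      then show ?case by (rule tendsto_eventually)
    qed
  qed (auto simp: emeasure_space_1 indicator_def)
  then have "(\<lambda>n. ennreal (prob (target_event (n0 + n)))) \<longlonglongrightarrow> ennreal (prob F)"
    by (simp add: emeasure_eq_measure)
  then show ?thesis unfolding p by (rule tendsto_ennrealD) auto
qed

text \<open>Up to the factor \<open>- Q e e\<close>, this is the expected time spent in \<open>i\<close> during an excursion
  from \<open>e\<close>, including the initial stay in \<open>e\<close>, whose mean is \<open>1 / (- Q e e)\<close>.\<close>

definition excursion_measure :: "int \<Rightarrow> real" where
  "excursion_measure i = (if i = e then 1 else excursion_occupation Q M X e i)"

text \<open>The balance of expected visits on the grid reads \<open>N (P - I) = 0\<close> off \<open>{e, c}\<close>. After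
  normalising \<open>N\<close> by its value at \<open>e\<close> and dividing by the mesh, \<open>N\<close> tends to the excursion
  measure and \<open>(P - I) / d\<close> to the rate matrix. In the column of \<open>c\<close> the same
  expression is the normalised probability of ending in \<open>c\<close>.\<close>

lemma excursion_balance:
  assumes c: "c = 3 - e"
  shows "j \<in> V - {e, c} \<Longrightarrow> (\<Sum>i\<in>V - {c}. excursion_measure i * Q i j) = 0"
    and "excursion_intensity Q M X e c = (\<Sum>i\<in>V - {c}. excursion_measure i * Q i c)"
proof -
  have "\<forall>\<^sub>F n in sequentially. 0 < mesh n \<and> (\<forall>i\<in>V - {c}. summable (\<lambda>m. grid_visit (mesh n) m i))"
    by (rule filterlim_iff[THEN iffD1, OF mesh_at_right, rule_format, OF summable_grid_visit])
  then obtain n0 where sum: "\<And>n. n0 \<le> n \<Longrightarrow> \<forall>i\<in>V - {c}. summable (\<lambda>m. grid_visit (mesh n) m i)"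
    by (auto simp: eventually_sequentially)
  define d where "d n = mesh (n0 + n)" for n
  have d_pos: "0 < d n" for n by (simp add: d_def mesh_pos)
  have d_lim: "filterlim d (at_right 0) sequentially"
  proof -
    have "filterlim (\<lambda>n. mesh (n + n0)) (at_right 0) sequentially"
      by (rule filterlim_compose[OF mesh_at_right]) (rule filterlim_add_const_nat_at_top)
    then show ?thesis by (simp add: d_def[abs_def] add.commute)
  qed
  have sum_d: "\<forall>i\<in>V - {c}. summable (\<lambda>m. grid_visit (d n) m i)" for n
    unfolding d_def by (rule sum) simp
  have rate: "(\<lambda>n. (trans_prob (d n) i j - of_bool (i = j)) / d n) \<longlonglongrightarrow> Q i j" if "i \<in> V" "j \<in> V" for i j
    by (rule filterlim_compose[OF trans_prob_derivative[OF that] d_lim])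
  define r where "r n = (1 - trans_prob (d n) e e) / d n" for n
  have r_lim: "r \<longlonglongrightarrow> - Q e e"
    using tendsto_minus[OF rate[OF start_state start_state]]
    by (simp add: r_def[abs_def] minus_divide_left)
  \<comment> \<open>The number of visits to \<open>i\<close> divided by the number of visits to \<open>e\<close>. In this form the
    factor \<open>r n\<close> converges to the exit rate and the rest is an expected occupation time.\<close>
  define Y where "Y n i = r n * (d n * grid_visits (d n) i)" for n i
  have Y_start: "Y n e = 1" for n
    using grid_visits_start[OF d_pos sum_d, of n] d_pos[of n]
    by (simp add: Y_def r_def mult.commute)
  have Y_lim: "(\<lambda>n. Y n i) \<longlonglongrightarrow> excursion_measure i" if i: "i \<in> V - {c}" for i
  proof (cases "i = e")
    case True
    then show ?thesis by (simp add: Y_start excursion_measure_def)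
  next
    case False
    have "Q e e \<noteq> 0" using exit_rate_pos[OF start_state target_state start_target_neq] by simp
    have "(\<lambda>n. r n / (- Q e e) * (- Q e e * (d n * grid_visits (d n) i)))
        \<longlonglongrightarrow> (- Q e e) / (- Q e e) * excursion_occupation Q M X e i"
      using \<open>Q e e \<noteq> 0\<close> i False
      unfolding d_def by (intro tendsto_intros r_lim occupation_limit sum c) (auto simp: r_lim)
    then show ?thesis
      using \<open>Q e e \<noteq> 0\<close> False by (simp add: Y_def[abs_def] excursion_measure_def)
  qed
  have flow: "(\<lambda>n. \<Sum>i\<in>V - {c}. Y n i * ((trans_prob (d n) i j - of_bool (i = j)) / d n))
      \<longlonglongrightarrow> (\<Sum>i\<in>V - {c}. excursion_measure i * Q i j)" if "j \<in> V" for j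
    using that by (intro tendsto_sum tendsto_mult Y_lim rate) auto
  have flow_eq: "(\<Sum>i\<in>V - {c}. Y n i * ((trans_prob (d n) i j - of_bool (i = j)) / d n))
      = r n * ((\<Sum>i\<in>V - {c}. grid_visits (d n) i * trans_prob (d n) i j)
          - (if j \<in> V - {c} then grid_visits (d n) j else 0))" for n j
  proof -
    have "(\<Sum>i\<in>V - {c}. Y n i * ((trans_prob (d n) i j - of_bool (i = j)) / d n))
        = (\<Sum>i\<in>V - {c}. r n * (grid_visits (d n) i * trans_prob (d n) i j - grid_visits (d n) i * of_bool (i = j)))"
      using d_pos[of n] by (intro sum.cong) (auto simp: Y_def field_simps)
    moreover have "(\<Sum>i\<in>V - {c}. grid_visits (d n) i * of_bool (i = j))
        = (if j \<in> V - {c} then grid_visits (d n) j else 0)"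
      using finite_states by (simp add: of_bool_def if_distrib[of "\<lambda>b. _ * b"] cong: if_cong)
    ultimately show ?thesis by (simp add: sum_distrib_left[symmetric] sum_subtractf)
  qed
  show "(\<Sum>i\<in>V - {c}. excursion_measure i * Q i j) = 0" if j: "j \<in> V - {e, c}"
  proof -
    have "(\<Sum>i\<in>V - {c}. Y n i * ((trans_prob (d n) i j - of_bool (i = j)) / d n)) = 0" for n
      unfolding flow_eq using grid_visits_balance[OF d_pos sum_d j] j by simp
    then show ?thesis using flow[of j] j by (simp add: LIMSEQ_const_iff)
  qed
  have "(\<lambda>n. r n * measure (M e) (target_event (n0 + n))) \<longlonglongrightarrow> - Q e e * excursion_prob M X e c"
    by (intro tendsto_mult r_lim target_limit sum c)
  moreover have "r n * measure (M e) (target_event (n0 + n))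
      = (\<Sum>i\<in>V - {c}. Y n i * ((trans_prob (d n) i c - of_bool (i = c)) / d n))" for n
    unfolding flow_eq using grid_hit_prob[OF d_pos sum_d, of n]
    by (simp add: target_event_def d_def)
  ultimately show "excursion_intensity Q M X e c = (\<Sum>i\<in>V - {c}. excursion_measure i * Q i c)"
    using LIMSEQ_unique flow[OF target_state] by (simp add: excursion_intensity_def)
qed

lemma excursion_occupation_nonneg: "0 \<le> excursion_occupation Q M X e i"
proof -
  have "0 \<le> - Q e e" using exit_rate_pos[OF start_state target_state start_target_neq] by simp
  then have "0 \<le> excursion_intensity Q M X e a" for a
    unfolding excursion_intensity_def excursion_prob_def
    by (rule mult_nonneg_nonneg) (rule measure_nonneg)
  moreover have "0 \<le> cond_occupation M X e a k" for a k
    by (simp add: cond_occupation_def excursion_prob_def)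
  ultimately show ?thesis unfolding excursion_occupation_def by (intro add_nonneg_nonneg mult_nonneg_nonneg)
qed

text \<open>If no excursion reached \<open>c\<close>, the states visited by excursions would form a closed
  set without \<open>c\<close>.\<close>

lemma excursion_intensity_pos:
  assumes c: "c = 3 - e"
  shows "0 < excursion_intensity Q M X e c"
proof -
  note balance = excursion_balance[OF c]
  have mu_nonneg: "0 \<le> excursion_measure i" for i by (simp add: excursion_measure_def excursion_occupation_nonneg)
  have nonneg: "0 \<le> excursion_measure i * Q i j" if "i \<in> V" "j \<in> V" "excursion_measure j = 0 \<or> j = c" "i \<noteq> c" for i j
    using mu_nonneg[of i] rate_nonneg[of i j] that by (cases "i = j") auto
  have "0 \<le> excursion_intensity Q M X e c"
    unfolding balance(2) using nonneg target_state by (intro sum_nonneg) auto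
  moreover have "excursion_intensity Q M X e c \<noteq> 0"
  proof
    assume zero: "excursion_intensity Q M X e c = 0"
    define C where "C = {i \<in> V - {c}. excursion_measure i \<noteq> 0}"
    have "e \<in> C" "C \<subseteq> V" "c \<in> V - C"
      using start_state target_state start_target_neq by (auto simp: C_def excursion_measure_def)
    then obtain k j where k: "k \<in> C" and j: "j \<in> V - C" and pos: "0 < Q k j"
      using no_closed_proper_subset by blast
    have j': "j \<in> V" "excursion_measure j = 0 \<or> j = c" "j \<noteq> e" using j \<open>e \<in> C\<close> by (auto simp: C_def)
    have "(\<Sum>i\<in>V - {c}. excursion_measure i * Q i j) = 0"
      using balance zero j' by (cases "j = c") auto
    then have "excursion_measure k * Q k j = 0"
      using finite_states nonneg j' k
      by (intro sum_nonneg_0[where f = "\<lambda>i. excursion_measure i * Q i j" and s = "V - {c}"]) (auto simp: C_def)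
    then show False using pos k by (simp add: C_def)
  qed
  ultimately show ?thesis by simp
qed

end

section \<open>Stationarity of the glued chain\<close>

context excursion
begin

text \<open>The flow through \<open>e\<close> itself is not computed: the rates sum to zero along rows, so the
  net inflows over all states cancel, and only \<open>e\<close> and \<open>c\<close> are out of balance.\<close>

lemma excursion_flow:
  assumes c: "c = 3 - e" and j: "j \<in> V"
  shows "(\<Sum>i\<in>V. (if i = c then 0 else if i = e then 1 else excursion_occupation Q M X e i) * Q i j)
       = excursion_intensity Q M X e c * (of_bool (j = c) - of_bool (j = e))"
proof -
  define F where "F j = (\<Sum>i\<in>V. (if i = c then 0 else excursion_measure i) * Q i j)" for j
  have F: "F j = (\<Sum>i\<in>V - {c}. excursion_measure i * Q i j)" for j
    unfolding F_def using finite_states by (intro sum.mono_neutral_cong_right) auto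
  have S: "F j = 0" if "j \<in> V - {e, c}" for j
    using excursion_balance(1)[OF c that] by (simp add: F)
  have at_c: "F c = excursion_intensity Q M X e c"
    using excursion_balance(2)[OF c] by (simp add: F)
  have "(\<Sum>j\<in>V. F j) = (\<Sum>i\<in>V. (if i = c then 0 else excursion_measure i) * (\<Sum>j\<in>V. Q i j))"
    unfolding F_def sum_distrib_left by (rule sum.swap)
  also have "\<dots> = 0" using row_sum_rates by simp
  finally have "(\<Sum>j\<in>V. F j) = 0" .
  moreover have "(\<Sum>j\<in>V. F j) = (\<Sum>j\<in>{e, c}. F j)"
    using S start_state target_state finite_states by (intro sum.mono_neutral_right) auto
  ultimately have "F e = - F c" using start_target_neq by simp
  then show ?thesis
    using S[of j] at_c start_target_neq j unfolding excursion_measure_def[symmetric] F_def[symmetric]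
    by (cases "j = e"; cases "j = c") auto
qed

end

context irreducible_ctmc
begin

context
  assumes states: "1 \<in> V" "2 \<in> V"
begin

lemma excursion_locales: "excursion V Q M X 1 2" "excursion V Q M X 2 1"
  by (intro excursion.intro excursion_axioms.intro irreducible_ctmc_axioms states; simp)+

text \<open>For a vector that is determined on the remaining states by its values at \<open>1\<close> and \<open>2\<close>,
  one number is left in the balance equations, namely the net flow from \<open>1\<close> to \<open>2\<close>. It is carried
  by the excursions, at the rates given by their intensities.\<close>

lemma combined_flow:
  assumes sol: "\<forall>i\<in>V - {1, 2}. \<rho> i = \<rho> 1 * excursion_occupation Q M X 1 i + \<rho> 2 * excursion_occupation Q M X 2 i"
    and j: "j \<in> V"
  shows "(\<Sum>i\<in>V. \<rho> i * Q i j)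
    = (\<rho> 1 * excursion_intensity Q M X 1 2 - \<rho> 2 * excursion_intensity Q M X 2 1)
        * (of_bool (j = 2) - of_bool (j = 1))"
proof -
  have "(\<Sum>i\<in>V. \<rho> i * Q i j) = (\<Sum>i\<in>V. \<rho> 1 * ((if i = 2 then 0 else if i = 1 then 1 else excursion_occupation Q M X 1 i) * Q i j)
      + \<rho> 2 * ((if i = 1 then 0 else if i = 2 then 1 else excursion_occupation Q M X 2 i) * Q i j))"
  proof (rule sum.cong[OF refl])
    fix i assume i: "i \<in> V"
    have "\<rho> i = \<rho> 1 * (if i = 2 then 0 else if i = 1 then 1 else excursion_occupation Q M X 1 i)
        + \<rho> 2 * (if i = 1 then 0 else if i = 2 then 1 else excursion_occupation Q M X 2 i)"
    proof (cases "i \<in> {1, 2}")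
      case False
      then have "i \<in> V - {1, 2}" using i by simp
      from bspec[OF sol this] False show ?thesis by simp
    qed auto
    then show "\<rho> i * Q i j = \<rho> 1 * ((if i = 2 then 0 else if i = 1 then 1 else excursion_occupation Q M X 1 i) * Q i j)
      + \<rho> 2 * ((if i = 1 then 0 else if i = 2 then 1 else excursion_occupation Q M X 2 i) * Q i j)"
      by (simp add: algebra_simps)
  qed
  also have "\<dots> = \<rho> 1 * (excursion_intensity Q M X 1 2 * (of_bool (j = 2) - of_bool (j = 1)))
      + \<rho> 2 * (excursion_intensity Q M X 2 1 * (of_bool (j = 1) - of_bool (j = 2)))"
    using excursion.excursion_flow[OF excursion_locales(1) _ j]
      excursion.excursion_flow[OF excursion_locales(2) _ j]
    by (simp add: sum.distrib sum_distrib_left[symmetric])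
  finally show ?thesis by (simp add: algebra_simps)
qed

text \<open>Both excursion measures satisfy the balance equations outside \<open>{1, 2}\<close>, so subtracting
  the combination with the same values at \<open>1\<close> and \<open>2\<close> leaves a null vector of the rates
  restricted to \<open>V - {1, 2}\<close>, and such a vector vanishes.\<close>

lemma balance_off_gates_iff:
  "(\<forall>j\<in>V - {1, 2}. (\<Sum>i\<in>V. \<rho> i * Q i j) = 0) \<longleftrightarrow>
   (\<forall>i\<in>V - {1, 2}. \<rho> i = \<rho> 1 * excursion_occupation Q M X 1 i + \<rho> 2 * excursion_occupation Q M X 2 i)"
proof
  assume sol: "\<forall>i\<in>V - {1, 2}. \<rho> i = \<rho> 1 * excursion_occupation Q M X 1 i + \<rho> 2 * excursion_occupation Q M X 2 i"
  show "\<forall>j\<in>V - {1, 2}. (\<Sum>i\<in>V. \<rho> i * Q i j) = 0"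
    using combined_flow[OF sol] by auto
next
  assume bal: "\<forall>j\<in>V - {1, 2}. (\<Sum>i\<in>V. \<rho> i * Q i j) = 0"
  \<comment> \<open>The solution with the values of \<open>\<rho>\<close> at \<open>1\<close> and \<open>2\<close>.\<close>
  define \<sigma> where "\<sigma> i = (if i \<in> {1, 2} then \<rho> i
      else \<rho> 1 * excursion_occupation Q M X 1 i + \<rho> 2 * excursion_occupation Q M X 2 i)" for i
  have "\<forall>i\<in>V - {1, 2}. \<sigma> i = \<sigma> 1 * excursion_occupation Q M X 1 i + \<sigma> 2 * excursion_occupation Q M X 2 i"
    by (simp add: \<sigma>_def)
  from combined_flow[OF this] have \<sigma>: "(\<Sum>i\<in>V. \<sigma> i * Q i j) = 0" if "j \<in> V - {1, 2}" for j
    using that by auto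
  have "\<rho> i - \<sigma> i = 0" if "i \<in> V - {1, 2}" for i
  proof (rule left_null_vector_zero[of 1 "V - {1, 2}" "\<lambda>i. \<rho> i - \<sigma> i"])
    fix j assume j: "j \<in> V - {1, 2}"
    have "(\<Sum>i\<in>V - {1, 2}. (\<rho> i - \<sigma> i) * Q i j) = (\<Sum>i\<in>V. (\<rho> i - \<sigma> i) * Q i j)"
      using finite_states by (intro sum.mono_neutral_left) (auto simp: \<sigma>_def)
    also have "\<dots> = 0" using bal \<sigma>[OF j] j by (simp add: left_diff_distrib sum_subtractf)
    finally show "(\<Sum>i\<in>V - {1, 2}. (\<rho> i - \<sigma> i) * Q i j) = 0" .
  qed (use states that in auto)
  then show "\<forall>i\<in>V - {1, 2}. \<rho> i = \<rho> 1 * excursion_occupation Q M X 1 i + \<rho> 2 * excursion_occupation Q M X 2 i"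
    by (auto simp: \<sigma>_def)
qed

lemma intensities_pos: "0 < excursion_intensity Q M X 1 2" "0 < excursion_intensity Q M X 2 1"
  using excursion.excursion_intensity_pos[OF excursion_locales(1)]
    excursion.excursion_intensity_pos[OF excursion_locales(2)] by auto

lemma occupations_nonneg: "0 \<le> excursion_occupation Q M X 1 i" "0 \<le> excursion_occupation Q M X 2 i"
  using excursion.excursion_occupation_nonneg[OF excursion_locales(1)]
    excursion.excursion_occupation_nonneg[OF excursion_locales(2)] by auto

end

end

theorem theorem1:
  fixes r s :: nat
    and QA QB Q :: "int \<Rightarrow> int \<Rightarrow> real"
    and MA :: "int \<Rightarrow> 'a measure" and XA :: "real \<Rightarrow> 'a \<Rightarrow> int"
    and MB :: "int \<Rightarrow> 'b measure" and XB :: "real \<Rightarrow> 'b \<Rightarrow> int"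
    and VA VB V SA SB :: "int set"
    and v w x y :: "int \<Rightarrow> real"
    and a12 a21 b12 b21 D :: real
  defines "VA \<equiv> {- int r + 3..2}" and "VB \<equiv> {1..int s}"
    and "SA \<equiv> {- int r + 3..0}" and "SB \<equiv> {3..int s}"
    and "V \<equiv> {- int r + 3..int s}"
    and "Q \<equiv> glued_rates QA QB"
    and "a12 \<equiv> excursion_intensity QA MA XA 1 2"
    and "a21 \<equiv> excursion_intensity QA MA XA 2 1"
    and "b12 \<equiv> excursion_intensity QB MB XB 1 2"
    and "b21 \<equiv> excursion_intensity QB MB XB 2 1"
    and "v \<equiv> excursion_occupation QA MA XA 1"
    and "w \<equiv> excursion_occupation QA MA XA 2"
    and "x \<equiv> excursion_occupation QB MB XB 1"
    and "y \<equiv> excursion_occupation QB MB XB 2"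
    and "D \<equiv> (a21 + b21) * ((\<Sum>i\<in>SA. v i) + (\<Sum>j\<in>SB. x j) + 1)
           + (a12 + b12) * ((\<Sum>i\<in>SA. w i) + (\<Sum>j\<in>SB. y j) + 1)"
  assumes "2 \<le> r" and "2 \<le> s"
    and "ctmc VA QA MA XA" and "irreducible_chain VA MA XA"
    and "ctmc VB QB MB XB" and "irreducible_chain VB MB XB"
  shows "\<exists>\<pi>.
      (\<forall>\<rho>. stationary_distribution V Q \<rho> \<longleftrightarrow> (\<forall>i\<in>V. \<rho> i = \<pi> i)) \<and>
      (\<forall>\<rho>. (\<forall>i\<in>SA. \<rho> i = \<rho> 1 * v i + \<rho> 2 * w i) \<and>
           (\<forall>j\<in>SB. \<rho> j = \<rho> 1 * x j + \<rho> 2 * y j) \<and>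
           (a12 + b12) * \<rho> 1 = (a21 + b21) * \<rho> 2 \<and>
           (\<Sum>i\<in>V. \<rho> i) = 1
         \<longleftrightarrow> (\<forall>i\<in>V. \<rho> i = \<pi> i)) \<and>
      \<pi> 1 = (a21 + b21) / D \<and>
      \<pi> 2 = (a12 + b12) / D"
proof -
  have chainA: "irreducible_ctmc VA QA MA XA" and chainB: "irreducible_ctmc VB QB MB XB"
    using assms by (auto intro!: irreducible_ctmc.intro irreducible_ctmc_axioms.intro)
  note rs = \<open>2 \<le> r\<close> \<open>2 \<le> s\<close>
  have inA: "1 \<in> VA" "2 \<in> VA" and inB: "1 \<in> VB" "2 \<in> VB"
    using rs by (auto simp: VA_def VB_def)
  have SA: "SA = VA - {1, 2}" and SB: "SB = VB - {1, 2}"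
    by (auto simp: VA_def VB_def SA_def SB_def)
  have V: "V = SA \<union> {1, 2} \<union> SB" using rs by (auto simp: V_def SA_def SB_def)
  note flowA = irreducible_ctmc.combined_flow[OF chainA inA, folded a12_def a21_def v_def w_def SA]
  note flowB = irreducible_ctmc.combined_flow[OF chainB inB, folded b12_def b21_def x_def y_def SB]
  note solA = irreducible_ctmc.balance_off_gates_iff[OF chainA inA, folded v_def w_def SA]
  note solB = irreducible_ctmc.balance_off_gates_iff[OF chainB inB, folded x_def y_def SB]

  define \<alpha> where "\<alpha> = a12 + b12"
  define \<beta> where "\<beta> = a21 + b21"
  define K where "K = (\<Sum>i\<in>SA. v i) + (\<Sum>j\<in>SB. x j) + 1"
  define L where "L = (\<Sum>i\<in>SA. w i) + (\<Sum>j\<in>SB. y j) + 1"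
  have D: "D = \<beta> * K + \<alpha> * L" by (simp add: D_def \<alpha>_def \<beta>_def K_def L_def)
  have pos: "0 < \<alpha>" "0 < \<beta>"
    using irreducible_ctmc.intensities_pos[OF chainA inA] irreducible_ctmc.intensities_pos[OF chainB inB]
    by (simp_all add: \<alpha>_def \<beta>_def a12_def a21_def b12_def b21_def)
  have occ: "0 \<le> v i" "0 \<le> w i" "0 \<le> x i" "0 \<le> y i" for i
    using irreducible_ctmc.occupations_nonneg[OF chainA inA] irreducible_ctmc.occupations_nonneg[OF chainB inB]
    by (simp_all add: v_def w_def x_def y_def)
  have KL: "1 \<le> K" "1 \<le> L" by (simp_all add: K_def L_def occ sum_nonneg)
  have Dpos: "0 < D" unfolding D using pos KL by (intro add_pos_pos mult_pos_pos) auto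

  \<comment> \<open>No transition joins the two sides directly, so each balance equation outside \<open>{1, 2}\<close>
    involves one of the two chains only, and at \<open>1\<close> and \<open>2\<close> the two net flows add up.\<close>
  have glued: "(\<Sum>i\<in>V. \<rho> i * Q i j) =
      (if j \<le> 2 then \<Sum>i\<in>VA. \<rho> i * QA i j else 0) + (if 1 \<le> j then \<Sum>i\<in>VB. \<rho> i * QB i j else 0)" for \<rho> j
  proof -
    have fin: "finite V" by (simp add: V_def)
    have A: "(\<Sum>i\<in>V. \<rho> i * (if i \<le> 2 \<and> j \<le> 2 then QA i j else 0)) = (if j \<le> 2 then \<Sum>i\<in>VA. \<rho> i * QA i j else 0)"
    proof (cases "j \<le> 2")
      case True
      have "VA \<subseteq> V" using rs by (auto simp: V_def VA_def)
      with True fin show ?thesis by (auto intro!: sum.mono_neutral_cong_right simp: V_def VA_def)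
    qed simp
    have B: "(\<Sum>i\<in>V. \<rho> i * (if 1 \<le> i \<and> 1 \<le> j then QB i j else 0)) = (if 1 \<le> j then \<Sum>i\<in>VB. \<rho> i * QB i j else 0)"
    proof (cases "1 \<le> j")
      case True
      have "VB \<subseteq> V" using rs by (auto simp: V_def VB_def)
      with True fin show ?thesis by (auto intro!: sum.mono_neutral_cong_right simp: V_def VB_def)
    qed simp
    show ?thesis
      unfolding Q_def glued_rates_def distrib_left sum.distrib A B ..
  qed

  define system where "system \<rho> \<longleftrightarrow>
    (\<forall>i\<in>SA. \<rho> i = \<rho> 1 * v i + \<rho> 2 * w i) \<and>
    (\<forall>j\<in>SB. \<rho> j = \<rho> 1 * x j + \<rho> 2 * y j) \<and> \<alpha> * \<rho> 1 = \<beta> * \<rho> 2" for \<rho>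
  have balance_iff: "(\<forall>j\<in>V. (\<Sum>i\<in>V. \<rho> i * Q i j) = 0) \<longleftrightarrow> system \<rho>" for \<rho>
  proof -
    have offA: "(\<forall>j\<in>SA. (\<Sum>i\<in>V. \<rho> i * Q i j) = 0) \<longleftrightarrow> (\<forall>i\<in>SA. \<rho> i = \<rho> 1 * v i + \<rho> 2 * w i)"
      unfolding solA[symmetric] by (intro ball_cong) (auto simp: glued SA_def)
    have offB: "(\<forall>j\<in>SB. (\<Sum>i\<in>V. \<rho> i * Q i j) = 0) \<longleftrightarrow> (\<forall>i\<in>SB. \<rho> i = \<rho> 1 * x i + \<rho> 2 * y i)"
      unfolding solB[symmetric] by (intro ball_cong) (auto simp: glued SB_def)
    have gates: "(\<forall>j\<in>{1, 2}. (\<Sum>i\<in>V. \<rho> i * Q i j) = 0) \<longleftrightarrow> \<alpha> * \<rho> 1 = \<beta> * \<rho> 2"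
      if "\<forall>i\<in>SA. \<rho> i = \<rho> 1 * v i + \<rho> 2 * w i" "\<forall>i\<in>SB. \<rho> i = \<rho> 1 * x i + \<rho> 2 * y i"
    proof -
      have "(\<Sum>i\<in>V. \<rho> i * Q i 1) = \<beta> * \<rho> 2 - \<alpha> * \<rho> 1"
        using flowA[OF that(1) inA(1)] flowB[OF that(2) inB(1)]
        by (simp add: glued \<alpha>_def \<beta>_def algebra_simps)
      moreover have "(\<Sum>i\<in>V. \<rho> i * Q i 2) = \<alpha> * \<rho> 1 - \<beta> * \<rho> 2"
        using flowA[OF that(1) inA(2)] flowB[OF that(2) inB(2)]
        by (simp add: glued \<alpha>_def \<beta>_def algebra_simps)
      ultimately show ?thesis by auto
    qed
    show ?thesis
      unfolding system_def V ball_Un unfolding V[symmetric] offA offB using gates by blast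
  qed

  define \<pi> where "\<pi> i = (if i = 1 then \<beta> / D else if i = 2 then \<alpha> / D
    else if i \<le> 0 then \<beta> / D * v i + \<alpha> / D * w i else \<beta> / D * x i + \<alpha> / D * y i)" for i
  have \<pi>12: "\<pi> 1 = \<beta> / D" "\<pi> 2 = \<alpha> / D" by (simp_all add: \<pi>_def)
  have \<pi>_system: "system \<pi>"
    unfolding system_def by (auto simp: \<pi>_def SA_def SB_def)
  have total: "(\<Sum>i\<in>V. \<rho> i) = \<rho> 1 * K + \<rho> 2 * L" if "system \<rho>" for \<rho>
  proof -
    have "(\<Sum>i\<in>V. \<rho> i) = (\<Sum>i\<in>SA. \<rho> i) + (\<rho> 1 + \<rho> 2) + (\<Sum>i\<in>SB. \<rho> i)"
      unfolding V by (subst sum.union_disjoint; (subst sum.union_disjoint)?) (auto simp: SA_def SB_def)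
    also have "(\<Sum>i\<in>SA. \<rho> i) = (\<Sum>i\<in>SA. \<rho> 1 * v i + \<rho> 2 * w i)"
      using that by (intro sum.cong) (auto simp: system_def)
    also have "(\<Sum>i\<in>SB. \<rho> i) = (\<Sum>i\<in>SB. \<rho> 1 * x i + \<rho> 2 * y i)"
      using that by (intro sum.cong) (auto simp: system_def)
    finally show ?thesis
      by (simp add: K_def L_def sum.distrib sum_distrib_left distrib_left)
  qed
  have system_iff: "system \<rho> \<and> (\<Sum>i\<in>V. \<rho> i) = 1 \<longleftrightarrow> (\<forall>i\<in>V. \<rho> i = \<pi> i)" for \<rho>
  proof
    assume sys: "system \<rho> \<and> (\<Sum>i\<in>V. \<rho> i) = 1"
    then have norm: "\<rho> 1 * K + \<rho> 2 * L = 1" and gate: "\<alpha> * \<rho> 1 = \<beta> * \<rho> 2"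
      using total[of \<rho>] by (auto simp: system_def)
    have "\<rho> 1 * D = \<beta> * (\<rho> 1 * K) + (\<alpha> * \<rho> 1) * L" by (simp add: D algebra_simps)
    also have "\<dots> = \<beta> * (\<rho> 1 * K + \<rho> 2 * L)" by (simp add: gate algebra_simps)
    finally have "\<rho> 1 * D = \<beta>" by (simp only: norm mult_1_right)
    then have 1: "\<rho> 1 = \<pi> 1" using Dpos by (simp add: \<pi>12 field_simps)
    have "\<rho> 2 * D = (\<beta> * \<rho> 2) * K + \<alpha> * (\<rho> 2 * L)" by (simp add: D algebra_simps)
    also have "\<dots> = \<alpha> * (\<rho> 1 * K + \<rho> 2 * L)" by (simp add: gate[symmetric] algebra_simps)
    finally have "\<rho> 2 * D = \<alpha>" by (simp only: norm mult_1_right)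
    then have 2: "\<rho> 2 = \<pi> 2" using Dpos by (simp add: \<pi>12 field_simps)
    show "\<forall>i\<in>V. \<rho> i = \<pi> i"
      using sys \<pi>_system 1 2 unfolding V system_def by auto
  next
    assume eq: "\<forall>i\<in>V. \<rho> i = \<pi> i"
    then have "system \<rho>" using \<pi>_system unfolding V system_def by auto
    moreover have "\<rho> 1 = \<beta> / D" "\<rho> 2 = \<alpha> / D" using eq by (simp_all add: V \<pi>12)
    then have "\<rho> 1 * K + \<rho> 2 * L = D / D" by (simp add: add_divide_distrib[symmetric] D)
    then have "(\<Sum>i\<in>V. \<rho> i) = 1" using total[OF \<open>system \<rho>\<close>] Dpos by simp
    ultimately show "system \<rho> \<and> (\<Sum>i\<in>V. \<rho> i) = 1" ..
  qed
  have "0 \<le> \<pi> i" for i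
    using pos Dpos occ by (auto simp: \<pi>_def)
  then have stationary_iff: "stationary_distribution V Q \<rho> \<longleftrightarrow> (\<forall>i\<in>V. \<rho> i = \<pi> i)" for \<rho>
    unfolding stationary_distribution_def balance_iff system_iff[symmetric]
    using system_iff[of \<rho>] by auto
  show ?thesis
    using stationary_iff system_iff \<pi>12
    unfolding system_def \<alpha>_def \<beta>_def by (intro exI[of _ \<pi>]) auto
qed

end
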